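(* Let $X\subset\{(x_1,\dots,x_9)\in\mathbb{R}^9\mid x_1+\cdots+x_9=4\}$ be a $4$-distance set containing $\tilde{J}(9,4)$. Then $|X|\leq 258$. If equality holds, then up to permutations of coordinates $X$ is one of \begin{enumerate} \item $\tilde{J}(9,4)\cup X^{(i)}\cup X^{(iii)}\cup\{(-4/3,(2/3)^8)\}\cup X^{(iv)'}$, \item $\tilde{J}(9,4)\cup X^{(i)}\cup X^{(iii)}\cup\{(-4/3,(2/3)^8)\}\cup X^{(iv)''}$, \item $\tilde{J}(9,4)\cup X^{(i)}\cup X^{(iii)}\cup\{(-4/3,(2/3)^8)\}\cup X^{(iv)'''}$. \end{enumerate}
   Context: A finite set in Euclidean space is an $s$-distance set if the set of Euclidean distances between pairs of distinct points has exactly $s$ elements. $\tilde{J}(9,4)\subset\mathbb{R}^9$ is the set of all $(0,1)$-vectors with exactly four entries $1$ (the Euclidean representation of the Johnson graph $J(9,4)$); its distances are $\sqrt2,\sqrt4,\sqrt6,\sqrt8$. Exponents inside a vector denote multiplicities, e.g. $(-4/3,(2/3)^8)$ has first entry $-4/3$ and eight entries $2/3$. $X^{(i)}$ is the set of all coordinate permutations of $((2/3)^7,(-1/3)^2)$, and $X^{(iii)}$ the set of all coordinate permutations of $(4/3,(1/3)^8)$. Let $L_{162}\subset\mathbb{R}^9$ be the set of vectors with one entry $-1$, six entries $0$, two entries $1$. For $1\le i\le 9$ let $S(i)=\{x\in L_{162}\mid x_1=\cdots=x_{i-1}=0,\ x_i=-1\}$ and $T(i)=\{x\in L_{162}\mid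 x_1=\cdots=x_{i-1}=0,\ x_i=1\}$ (for $i=1$ just $x_1=-1$, resp. $x_1=1$). Let $X_6=T(7)\cup\bigcup_{i=1}^7S(i)$, $Y_6=T(6)\cup\bigcup_{i=1}^5S(i)$, $Z_6=T(5)\cup\bigcup_{i=1}^4S(i)$. Let $\varphi$ be the map replacing each coordinate $-1,0,1$ by $-2/3,1/3,4/3$ respectively, and set $X^{(iv)'}=\varphi(X_6)$, $X^{(iv)''}=\varphi(Y_6)$, $X^{(iv)'''}=\varphi(Z_6)$. *)

theory Defs
  imports "HOL-Analysis.Analysis" "HOL-Combinatorics.Permutations"
begin

definition distance_set :: "nat \<Rightarrow> 'a::metric_space set \<Rightarrow> bool" where
  "distance_set s X \<longleftrightarrow>
     finite X \<and> card {dist x y | x y. x \<in> X \<and> y \<in> X \<and> x \<noteq> y} = s"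

text \<open>
  The coordinates \<open>x\<^sub>1, \<dots>, x\<^sub>9\<close> of a vector \<open>x :: real ^ 9\<close> are \<open>x $ 1\<close>, \<open>\<dots>\<close>, \<open>x $ 9\<close>,
  the convention also used by \<^const>\<open>vector\<close>. The numeral type \<open>9\<close> computes modulo 9, so that
  \<open>9 = 0\<close> there; its own linear order, in which \<open>9\<close> is least, is therefore never used, and
  statements that depend on the order of the coordinates take an index in \<^typ>\<open>nat\<close>.
\<close>

definition permute_coords :: "('n \<Rightarrow> 'n) \<Rightarrow> 'a ^ 'n \<Rightarrow> 'a ^ 'n::finite" where
  "permute_coords p x = (\<chi> i. x $ p i)"

definition coord_permutations :: "'a ^ 'n \<Rightarrow> ('a ^ 'n::finite) set" where
  "coord_permutations x = {permute_coords p x | p. p permutes UNIV}"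

definition J94 :: "(real ^ 9) set" where
  "J94 = {x. (\<forall>i. x $ i \<in> {0, 1}) \<and> card {i. x $ i = 1} = 4}"

definition X_i :: "(real ^ 9) set" where
  "X_i = coord_permutations (vector (replicate 7 (2/3) @ replicate 2 (-1/3)))"

definition X_iii :: "(real ^ 9) set" where
  "X_iii = coord_permutations (vector (4/3 # replicate 8 (1/3)))"

definition L162 :: "(real ^ 9) set" where
  "L162 = {x. card {i. x $ i = -1} = 1 \<and> card {i. x $ i = 0} = 6 \<and> card {i. x $ i = 1} = 2}"

definition S_set :: "nat \<Rightarrow> (real ^ 9) set" where
  "S_set i = {x \<in> L162. (\<forall>j\<in>{1..<i}. x $ of_nat j = 0) \<and> x $ of_nat i = -1}"

definition T_set :: "nat \<Rightarrow> (real ^ 9) set" where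
  "T_set i = {x \<in> L162. (\<forall>j\<in>{1..<i}. x $ of_nat j = 0) \<and> x $ of_nat i = 1}"

definition X6 :: "(real ^ 9) set" where
  "X6 = T_set 7 \<union> (\<Union>i\<in>{1..7}. S_set i)"

definition Y6 :: "(real ^ 9) set" where
  "Y6 = T_set 6 \<union> (\<Union>i\<in>{1..5}. S_set i)"

definition Z6 :: "(real ^ 9) set" where
  "Z6 = T_set 5 \<union> (\<Union>i\<in>{1..4}. S_set i)"

text \<open>Only applied to vectors with all entries in \<open>{-1, 0, 1}\<close>; the last branch is the entry \<open>1\<close>.\<close>

definition phi :: "real ^ 9 \<Rightarrow> real ^ 9" where
  "phi x = (\<chi> i. if x $ i = -1 then -2/3 else if x $ i = 0 then 1/3 else 4/3)"

definition X_iv' :: "(real ^ 9) set" where "X_iv' = phi ` X6"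
definition X_iv'' :: "(real ^ 9) set" where "X_iv'' = phi ` Y6"
definition X_iv''' :: "(real ^ 9) set" where "X_iv''' = phi ` Z6"

end

theory Submission
  imports Defs
begin

text \<open>
  Let \<open>x\<close> be a point outside the Johnson graph. Exchanging one index of a 4-subset shows that the
  coordinates differ by integers, and the largest and smallest sums over four coordinates differ by at
  most 3, so the deviations from the median coordinate have total absolute value at most 3. The
  equation for the norm then leaves only the types \<open>((2/3)^7,(-1/3)^2)\<close>, \<open>(-4/3,(2/3)^8)\<close>,
  \<open>(4/3,(1/3)^8)\<close> and \<open>(-2/3,(4/3)^2,(1/3)^6)\<close>.

  The first and third types contribute at most \<open>36 + 9\<close> points. A point of the last type is a triple of
  indices with a distinguished centre, and the only forbidden configurations are two triples
  \<open>{i,j,k}\<close>, \<open>{i,j,l}\<close> with centres \<open>i\<close>, \<open>j\<close> and a point of the second type whose exceptional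
  coordinate is a non-centre. Call \<open>i\<close> and \<open>j\<close> linked if both are centres of one triple; this triple is
  then unique. The number of centred triples is \<open>84\<close> plus the number of links minus the number of
  triples having no or three centres. Two adjacent links span such a bad triple, and two disjoint links
  produce a bad triple among the four triples that meet both of them and contain one of them; deleting vertices one by one
  shows that the difference is at most 2, with equality only if the links form a complete graph on
  three or four vertices and the bad triples are those inside it. This determines the family up to a
  linear order of the remaining vertices.
\<close>

section \<open>Elementary counting facts\<close>

lemma eq_singletonI:
  assumes "finite A" "card A \<le> Suc 0" "x \<in> A"
  shows "A = {x}"
  using assms by (auto simp: card_le_Suc0_iff_eq)

text \<open>A vertex with \<open>n\<close> neighbours will turn out to lie in at least
  \<open>n choose 2\<close> bad triples, so a vertex with fewer bad triples than neighbours must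
  have degree 1 or 2.\<close>

lemma choose_two_less:
  assumes "n choose 2 < n"
  shows "n = 1 \<or> n = 2"
proof -
  have "n * (n - 1) div 2 < n" using assms by (simp add: choose_two)
  then have "n < 3"
  proof (rule contrapos_pp)
    assume "\<not> n < 3"
    then have "n * 2 \<le> n * (n - 1)" by (intro mult_le_mono) auto
    then show "\<not> n * (n - 1) div 2 < n" by linarith
  qed
  moreover have "n \<noteq> 0" using assms by auto
  ultimately show ?thesis by auto
qed

lemma three_distinct:
  assumes "3 \<le> card K"
  obtains x y z where "x \<in> K" "y \<in> K" "z \<in> K" "x \<noteq> y" "x \<noteq> z" "y \<noteq> z"
proof -
  obtain S where "S \<subseteq> K" "card S = 3" using obtain_subset_with_card_n[OF assms] by metis
  then obtain x y z where "S = {x,y,z}" "x \<noteq> y" "x \<noteq> z" "y \<noteq> z" by (auto simp: card_3_iff)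
  then show ?thesis using \<open>S \<subseteq> K\<close> by (intro that[of x y z]) auto
qed

lemma triple_pairE:
  assumes "card T = 3" "i \<in> T" "j \<in> T" "i \<noteq> j"
  obtains k where "T = {i,j,k}" "k \<noteq> i" "k \<noteq> j"
proof -
  have "card (T - {i,j}) = 1" using assms by (simp add: card_Diff_subset)
  then obtain k where "T - {i,j} = {k}" by (auto simp: card_1_singleton_iff)
  then have "T = {i,j,k}" "k \<noteq> i" "k \<noteq> j" using assms by auto
  then show ?thesis using that by blast
qed

subsection \<open>Centred triples\<close>

text \<open>\<^term>\<open>i \<in> F {i,j,k}\<close> encodes that the point with entry \<open>-2/3\<close> at \<open>i\<close>, \<open>4/3\<close> at \<open>j\<close> and
  \<open>k\<close> and \<open>1/3\<close> elsewhere belongs to the set. The second axiom excludes the squared distance 10.\<close>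

locale centre_family =
  fixes F :: "'a::finite set \<Rightarrow> 'a set"
  assumes centre_subset: "F T \<subseteq> T"
    and centre_unique: "\<lbrakk>i \<in> F {i,j,k}; j \<in> F {i,j,l}; i \<noteq> j; k \<notin> {i,j}; l \<notin> {i,j}\<rbrakk> \<Longrightarrow> k = l"
begin

definition linked :: "'a \<Rightarrow> 'a \<Rightarrow> bool" where
  "linked i j \<longleftrightarrow> i \<noteq> j \<and> (\<exists>k. k \<notin> {i,j} \<and> {i,j} \<subseteq> F {i,j,k})"

definition bad :: "'a set \<Rightarrow> bool" where
  "bad T \<longleftrightarrow> F T = {} \<or> F T = T"

definition links :: "'a set \<Rightarrow> 'a set set" where
  "links U = {{i,j} | i j. linked i j \<and> i \<in> U \<and> j \<in> U}"

definition bads :: "'a set \<Rightarrow> 'a set set" where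
  "bads U = {T. T \<subseteq> U \<and> card T = 3 \<and> bad T}"

text \<open>A triple with \<open>t\<close> centres contains \<open>t choose 2\<close> links inside its set of centres, and
  \<open>t - 1 = (t choose 2) - 1\<close> or \<open>t choose 2\<close> according as \<open>t \<in> {0, 3}\<close> or \<open>t \<in> {1, 2}\<close>. Hence the excess
  over one centre per triple is a number of links minus a number of bad triples, and unlike the number of centres
  this difference is easily controlled when a vertex is deleted.\<close>

definition excess :: "'a set \<Rightarrow> int" where
  "excess U = int (card (links U)) - int (card (bads U))"

definition nbrs :: "'a set \<Rightarrow> 'a \<Rightarrow> 'a set" where
  "nbrs U v = {u \<in> U. linked v u}"

definition bads_at :: "'a set \<Rightarrow> 'a \<Rightarrow> 'a set set" where
  "bads_at U v = {T \<in> bads U. v \<in> T}"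

lemma linked_sym: "linked i j \<Longrightarrow> linked j i"
  unfolding linked_def by (metis insert_commute)

lemma linked_irrefl: "\<not> linked i i"
  by (simp add: linked_def)

lemma linkedE:
  assumes "linked i j"
  obtains k where "i \<noteq> j" "k \<noteq> i" "k \<noteq> j" "i \<in> F {i,j,k}" "j \<in> F {i,j,k}"
  using assms unfolding linked_def by auto

subsection \<open>The excess is at most 2\<close>

text \<open>If the link \<open>i\<close>, \<open>j\<close> is carried by \<open>{i,j,l}\<close>,
  then \<open>centre_unique\<close> forces the link \<open>i\<close>, \<open>l\<close> to be carried
  by the same triple, and all three vertices are centres. Otherwise any centre of
  \<open>{i,j,l}\<close> would clash with a witness of one of the two links, so there is
  none.\<close>

lemma bad_adjacent:
  assumes "linked i j" "linked i l" "j \<noteq> l"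
  shows "bad {i,j,l}"
proof -
  obtain k where k: "i \<noteq> j" "k \<noteq> i" "k \<noteq> j" "i \<in> F {i,j,k}" "j \<in> F {i,j,k}"
    using linkedE[OF assms(1)] by metis
  obtain m where m: "i \<noteq> l" "m \<noteq> i" "m \<noteq> l" "i \<in> F {i,l,m}" "l \<in> F {i,l,m}"
    using linkedE[OF assms(2)] by metis
  have perm: "{i,l,j} = {i,j,l}" "{j,i,l} = {i,j,l}" "{j,i,k} = {i,j,k}" "{l,i,j} = {i,j,l}" "{l,i,m} = {i,l,m}" by auto
  show ?thesis
  proof (cases "k = l")
    case True
    then have "m = j" using centre_unique[of i l j m] k m assms(3) perm by auto
    then have "F {i,j,l} = {i,j,l}" using True k m perm centre_subset[of "{i,j,l}"] by auto
    then show ?thesis by (simp add: bad_def)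
  next
    case False
    have 1: "i \<notin> F {i,j,l}" using centre_unique[of i j l k] k m False assms(3) by auto
    have 2: "j \<notin> F {i,j,l}" using centre_unique[of j i l k] k m False assms(3) perm by auto
    have 3: "l \<notin> F {i,j,l}"
    proof
      assume "l \<in> F {i,j,l}"
      then have "j = m" using centre_unique[of l i j m] m k assms(3) perm by auto
      then show False using m 1 perm by auto
    qed
    show ?thesis using 1 2 3 centre_subset[of "{i,j,l}"] unfolding bad_def by blast
  qed
qed

text \<open>By \<open>centre_unique\<close> the link is carried by a single triple
  \<open>{i,j,k}\<close>. For \<open>l = k\<close> both \<open>i\<close> and \<open>j\<close> are
  centres, for any other \<open>l\<close> neither is; the status of \<open>l\<close> is then fixed
  by the triple not being bad.\<close>

lemma not_bad_cases:
  assumes "linked i j" "l \<notin> {i,j}" "\<not> bad {i,j,l}"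
  shows "F {i,j,l} = {l} \<or> F {i,j,l} = {i,j}"
proof -
  obtain k where k: "i \<noteq> j" "k \<noteq> i" "k \<noteq> j" "i \<in> F {i,j,k}" "j \<in> F {i,j,k}"
    using linkedE[OF assms(1)] by metis
  have perm: "{j,i,l} = {i,j,l}" "{j,i,k} = {i,j,k}" by auto
  have a: "i \<in> F {i,j,l} \<Longrightarrow> l = k" using centre_unique[of i j l k] k assms(2) by auto
  have b: "j \<in> F {i,j,l} \<Longrightarrow> l = k" using centre_unique[of j i l k] k assms(2) perm by auto
  show ?thesis
  proof (cases "l = k")
    case True
    then show ?thesis using k centre_subset[of "{i,j,l}"] assms(3) unfolding bad_def by blast
  next
    case False
    then show ?thesis using a b centre_subset[of "{i,j,l}"] assms(3) unfolding bad_def by blast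
  qed
qed

text \<open>If none of the four triples were bad, \<open>not_bad_cases\<close> would leave two
  options for each. Were \<open>p\<close> the only centre of \<open>{i,j,p}\<close>, uniqueness
  would keep \<open>i\<close> and \<open>j\<close> from being centres of their triples with
  \<open>p\<close> and \<open>q\<close>, and the link \<open>p\<close>, \<open>q\<close> would be
  carried by two triples; the same argument applies to \<open>q\<close>. Otherwise the link
  \<open>i\<close>, \<open>j\<close> is carried by two triples.\<close>

lemma disjoint_links_bad:
  assumes "linked i j" "linked p q" "{i,j} \<inter> {p,q} = {}"
  shows "bad {i,j,p} \<or> bad {i,j,q} \<or> bad {p,q,i} \<or> bad {p,q,j}"
proof (rule ccontr)
  assume neg: "\<not> ?thesis"
  have ne: "i \<noteq> j" "p \<noteq> q" "i \<noteq> p" "i \<noteq> q" "j \<noteq> p" "j \<noteq> q"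
    using assms linked_irrefl by auto
  have cases_of: "F {i,j,p} = {p} \<or> F {i,j,p} = {i,j}" "F {i,j,q} = {q} \<or> F {i,j,q} = {i,j}"
    "F {p,q,i} = {i} \<or> F {p,q,i} = {p,q}" "F {p,q,j} = {j} \<or> F {p,q,j} = {p,q}"
    using not_bad_cases[of i j p] not_bad_cases[of i j q] not_bad_cases[of p q i]
      not_bad_cases[of p q j] assms neg by auto
  have perm: "{p,i,j} = {i,j,p}" "{i,p,q} = {p,q,i}" "{p,i,q} = {p,q,i}" "{p,j,i} = {i,j,p}"
    "{p,j,q} = {p,q,j}" "{q,p,j} = {p,q,j}" "{j,i,q} = {i,j,q}"
    by auto
  have "F {i,j,p} \<noteq> {p}"
  proof
    assume p: "F {i,j,p} = {p}"
    have "i \<notin> F {p,q,i}" using centre_unique[of p i j q] p ne perm by auto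
    moreover have "j \<notin> F {p,q,j}" using centre_unique[of p j i q] p ne perm by auto
    ultimately have "F {p,q,i} = {p,q}" "F {p,q,j} = {p,q}" using cases_of by auto
    then show False using centre_unique[of p q i j] ne by auto
  qed
  moreover have "F {i,j,q} \<noteq> {q}"
  proof
    assume p: "F {i,j,q} = {q}"
    have perm': "{q,i,j} = {i,j,q}" "{q,i,p} = {p,q,i}" "{q,j,i} = {i,j,q}"
    "{q,j,p} = {p,q,j}" by auto
    have "i \<notin> F {p,q,i}" using centre_unique[of q i j p] p ne perm' by auto
    moreover have "j \<notin> F {p,q,j}" using centre_unique[of q j i p] p ne perm' by auto
    ultimately have "F {p,q,i} = {p,q}" "F {p,q,j} = {p,q}" using cases_of by auto
    then show False using centre_unique[of p q i j] ne by auto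
  qed
  ultimately have "F {i,j,p} = {i,j}" "F {i,j,q} = {i,j}" using cases_of by auto
  then show False using centre_unique[of i j p q] ne by auto
qed

lemma linksE:
  assumes "e \<in> links U"
  obtains i j where "e = {i,j}" "linked i j" "i \<in> U" "j \<in> U" "i \<noteq> j"
proof -
  obtain i j where "e = {i,j}" "linked i j" "i \<in> U" "j \<in> U"
    using assms by (auto simp: links_def)
  moreover from this have "i \<noteq> j" using linked_irrefl by auto
  ultimately show ?thesis using that by blast
qed

lemma links_subset: "links U \<subseteq> {e. e \<subseteq> U \<and> card e = 2}"
  using linked_irrefl by (fastforce simp: links_def card_2_iff)

lemma links_remove:
  assumes "v \<in> U"
  shows "links U = links (U - {v}) \<union> (\<lambda>u. {v,u}) ` nbrs U v"
proof (intro equalityI subsetI)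
  fix e assume "e \<in> links U"
  then obtain i j where e: "e = {i,j}" "linked i j" "i \<in> U" "j \<in> U" by (auto simp: links_def)
  show "e \<in> links (U - {v}) \<union> (\<lambda>u. {v,u}) ` nbrs U v"
  proof (cases "i = v \<or> j = v")
    case True
    then show ?thesis using e linked_sym[of i j] by (auto simp: nbrs_def insert_commute)
  next
    case False
    then show ?thesis using e by (auto simp: links_def)
  qed
next
  fix e assume "e \<in> links (U - {v}) \<union> (\<lambda>u. {v,u}) ` nbrs U v"
  then show "e \<in> links U" using assms by (auto simp: links_def nbrs_def)
qed

lemma excess_remove:
  assumes "v \<in> U"
  shows "excess U = excess (U - {v}) + int (card (nbrs U v)) - int (card (bads_at U v))"
proof -
  note l = links_remove[OF assms]
  have d: "links (U - {v}) \<inter> (\<lambda>u. {v,u}) ` nbrs U v = {}"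
  proof (rule equals0I)
    fix e assume "e \<in> links (U - {v}) \<inter> (\<lambda>u. {v,u}) ` nbrs U v"
    then have e: "e \<in> links (U - {v})" and ve: "e \<in> (\<lambda>u. {v,u}) ` nbrs U v" by simp_all
    from ve have "v \<in> e" by auto
    moreover have "e \<subseteq> U - {v}" using e links_subset by fast
    ultimately show False by auto
  qed
  have "inj_on (\<lambda>u. {v,u}) (nbrs U v)"
    by (auto simp: inj_on_def doubleton_eq_iff)
  then have "card (links U) = card (links (U - {v})) + card (nbrs U v)"
    using card_Un_disjoint[OF _ _ d] by (simp add: l[symmetric] card_image)
  moreover have "bads U = bads (U - {v}) \<union> bads_at U v" "bads (U - {v}) \<inter> bads_at U v = {}"
    by (auto simp: bads_def bads_at_def)
  then have "card (bads U) = card (bads (U - {v})) + card (bads_at U v)"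
    by (simp add: card_Un_disjoint)
  ultimately show ?thesis by (simp add: excess_def)
qed

lemma links_pair: "{i,j} \<in> links U \<longleftrightarrow> linked i j \<and> i \<in> U \<and> j \<in> U"
  using linked_sym unfolding links_def by (auto simp: doubleton_eq_iff)

text \<open>By \<open>bad_adjacent\<close> every pair of neighbours of \<open>v\<close> spans a bad
  triple with \<open>v\<close>, and different pairs give different triples. The right-hand side
  keeps to these triples so that the equality case can count further ones besides them.\<close>

lemma bads_at_choose:
  assumes "v \<in> U"
  shows "card (nbrs U v) choose 2 \<le> card {T \<in> bads_at U v. T - {v} \<subseteq> nbrs U v}"
proof -
  let ?P = "{e. e \<subseteq> nbrs U v \<and> card e = 2}"
  have vn: "v \<notin> nbrs U v" using linked_irrefl by (simp add: nbrs_def)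
  have "insert v e \<in> bads_at U v \<and> insert v e - {v} \<subseteq> nbrs U v" if "e \<in> ?P" for e
  proof -
    obtain x y where e: "e = {x,y}" "x \<noteq> y" using \<open>e \<in> ?P\<close> by (auto simp: card_2_iff)
    have xy: "linked v x" "linked v y" "x \<in> U" "y \<in> U" using \<open>e \<in> ?P\<close> e by (auto simp: nbrs_def)
    then have "bad {v,x,y}" using bad_adjacent e by auto
    moreover have "card {v,x,y} = 3" using e vn \<open>e \<in> ?P\<close> by (simp add: card_insert_if) blast
    ultimately show ?thesis using xy e assms \<open>e \<in> ?P\<close> by (auto simp: bads_at_def bads_def)
  qed
  moreover have "inj_on (insert v) ?P"
    by (rule inj_onI) (use vn in \<open>metis insert_ident mem_Collect_eq subsetD\<close>)
  ultimately have "card ?P \<le> card {T \<in> bads_at U v. T - {v} \<subseteq> nbrs U v}"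
    by (intro card_inj_on_le) auto
  then show ?thesis by (simp add: n_subsets)
qed

lemma bad_in_bads_at:
  assumes "bad T" "T = {x,y,z}" "x \<noteq> y" "x \<noteq> z" "y \<noteq> z" "x \<in> U" "y \<in> U" "z \<in> U" "v \<in> T"
  shows "T \<in> bads_at U v"
  using assms by (simp add: bads_at_def bads_def)

lemma finite_bads_at [simp]: "finite (bads_at U v)"
  by simp

text \<open>Base of both inductions. If the triple \<open>U\<close> is bad, one is subtracted from
  at most three links. If it is not bad there is at most one link, since two links on three vertices
  share a vertex and make \<open>U\<close> bad.\<close>

lemma excess_card_3:
  assumes "card U \<le> 3"
  shows "excess U \<le> 2 \<and> (excess U = 2 \<longrightarrow> card U = 3 \<and> links U = {e. e \<subseteq> U \<and> card e = 2})"
proof -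
  have le: "card (links U) \<le> card U choose 2"
    using card_mono[OF _ links_subset[of U]] n_subsets[of U 2] by simp
  show ?thesis
  proof (cases "card U = 3")
    case False
    then have "card U = 0 \<or> card U = 1 \<or> card U = 2" using assms by linarith
    then have "card U choose 2 \<le> 1" by (elim disjE) (auto simp: choose_two)
    then show ?thesis using le by (simp add: excess_def)
  next
    case True
    show ?thesis
    proof (cases "bad U")
      case True
      have "T = U" if "T \<subseteq> U" "card T = 3" for T
        using card_subset_eq[of U T] that \<open>card U = 3\<close> by simp
      then have "bads U = {U}" using True \<open>card U = 3\<close> by (auto simp: bads_def)
      then have ex: "excess U = int (card (links U)) - 1" by (simp add: excess_def)
      have "card U choose 2 = 3" using \<open>card U = 3\<close> by (simp add: choose_two)
      then have "card (links U) \<le> 3" using le by simp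
      moreover have "links U = {e. e \<subseteq> U \<and> card e = 2}" if "card (links U) = 3"
        using card_subset_eq[OF _ links_subset[of U]] that n_subsets[of U 2] \<open>card U choose 2 = 3\<close>
        by simp
      ultimately show ?thesis using ex \<open>card U = 3\<close> by auto
    next
      case False
      have "e = e'" if e_in: "e \<in> links U" and e_in': "e' \<in> links U" for e e'
      proof (rule ccontr)
        assume ne: "e \<noteq> e'"
        obtain i j where e: "e = {i,j}" "linked i j" "i \<in> U" "j \<in> U" "i \<noteq> j"
          using e_in by (rule linksE)
        obtain p q where e': "e' = {p,q}" "linked p q" "p \<in> U" "q \<in> U" "p \<noteq> q"
          using e_in' by (rule linksE)
        have "card (e \<union> e') \<le> 3" using card_mono[of U "e \<union> e'"] \<open>card U = 3\<close> e e' by auto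
        moreover have "card (e \<union> e') = 4" if "e \<inter> e' = {}"
          using that e(1,5) e'(1,5) by (simp add: card_Un_disjoint)
        ultimately have "e \<inter> e' \<noteq> {}" by linarith
        then have "(i = p \<and> j \<noteq> q) \<or> (i = q \<and> j \<noteq> p) \<or> (j = p \<and> i \<noteq> q) \<or> (j = q \<and> i \<noteq> p)"
          using e(1) e'(1) ne by (auto simp: doubleton_eq_iff)
        then obtain x y z where xyz: "linked x y" "linked x z" "y \<noteq> z" "x \<in> U" "y \<in> U" "z \<in> U"
        proof (elim disjE conjE)
          assume "i = p" "j \<noteq> q"
          then show ?thesis using e e' by (intro that[of i j q]) auto
        next
          assume "i = q" "j \<noteq> p"
          then show ?thesis using e e' linked_sym[OF e'(2)] by (intro that[of i j p]) auto
        next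
          assume "j = p" "i \<noteq> q"
          then show ?thesis using e e' linked_sym[OF e(2)] by (intro that[of j i q]) auto
        next
          assume "j = q" "i \<noteq> p"
          then show ?thesis using e e' linked_sym[OF e(2)] linked_sym[OF e'(2)] by (intro that[of j i p]) auto
        qed
        then have "x \<noteq> y" "x \<noteq> z" using linked_irrefl by auto
        then have "{x,y,z} = U" using xyz \<open>card U = 3\<close> by (intro card_subset_eq) simp_all
        then show False using bad_adjacent[OF xyz(1-3)] False by simp
      qed
      then have "card (links U) \<le> 1" by (simp add: card_le_Suc0_iff_eq)
      then show ?thesis by (simp add: excess_def)
    qed
  qed
qed

text \<open>Otherwise every vertex has degree 1 or 2 by \<open>bads_at_choose\<close>, and so at
  most one bad triple. With at least four vertices, a link chosen away from a given link or triangle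
  yields a bad triple too many, through \<open>bad_adjacent\<close> or
  \<open>disjoint_links_bad\<close>.\<close>

lemma removable_vertex:
  assumes "card U \<ge> 4"
  shows "\<exists>v\<in>U. card (nbrs U v) \<le> card (bads_at U v)"
proof (rule ccontr)
  assume "\<not> ?thesis"
  then have lt: "card (bads_at U v) < card (nbrs U v)" if "v \<in> U" for v
    using that by force
  have "card (nbrs U v) choose 2 \<le> card (bads_at U v)" if "v \<in> U" for v
    using bads_at_choose[OF that]
    by (rule order_trans) (rule card_mono, auto)
  then have deg: "card (nbrs U v) = 1 \<or> card (nbrs U v) = 2" if "v \<in> U" for v
    using lt choose_two_less that by (meson le_less_trans)
  have nbr_ex: "\<exists>q. linked p q \<and> q \<in> U" if "p \<in> U" for p
    using deg[OF that] by (auto simp: nbrs_def card_1_singleton_iff card_2_iff)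
  show False
  proof (cases "\<exists>v\<in>U. card (nbrs U v) = 2")
    case True
    then obtain v j l where v: "v \<in> U" "nbrs U v = {j,l}" "j \<noteq> l" by (auto simp: card_2_iff)
    then have vjl: "linked v j" "linked v l" "j \<in> U" "l \<in> U" "v \<noteq> j" "v \<noteq> l"
      using linked_irrefl by (auto simp: nbrs_def)
    have T: "{v,j,l} \<in> bads_at U x" if "x \<in> {v,j,l}" for x
      using bad_in_bads_at[OF bad_adjacent[OF vjl(1,2) v(3)] refl] v vjl that by auto
    \<comment> \<open>Each of \<open>v\<close>, \<open>j\<close>, \<open>l\<close> has at most two
      neighbours, hence at most one bad triple, and that one is \<open>{v,j,l}\<close>. It remains
      to find a bad triple that contains one of these vertices and also a vertex outside.\<close>
    have only: "bads_at U x = {{v,j,l}}" if "x \<in> {v,j,l}" for x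
    proof -
      have "x \<in> U" using v vjl that by auto
      then have "card (bads_at U x) \<le> Suc 0" using lt deg by fastforce
      then show ?thesis using T[OF that] by (intro eq_singletonI) auto
    qed
    have "\<not> U \<subseteq> {v,j,l}" using assms card_mono[of "{v,j,l}" U] v vjl by auto
    then obtain p where p: "p \<in> U" "p \<notin> {v,j,l}" by auto
    obtain q where q: "linked p q" "q \<in> U" using nbr_ex[OF p(1)] by auto
    have no_bad: False if T: "bad T" "T = {x,y,z}" "x \<noteq> y" "x \<noteq> z" "y \<noteq> z" "x \<in> U" "y \<in> U" "z \<in> U"
      "w \<in> T" "w \<in> {v,j,l}" "p \<in> T" for T x y z w
    proof -
      have "T \<in> bads_at U w" by (rule bad_in_bads_at[OF T(1-9)])
      then have "T = {v,j,l}" using only[OF T(10)] by simp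
      then show False using T(11) p(2) by simp
    qed
    have no_bad': False if T: "bad T" "T = {x,y,z}" "x \<noteq> y" "x \<noteq> z" "y \<noteq> z" "x \<in> U" "y \<in> U" "z \<in> U"
      "w \<in> T" "w \<in> {v,j,l}" "q \<in> T" "q \<notin> {v,j,l}" for T x y z w
    proof -
      have "T \<in> bads_at U w" by (rule bad_in_bads_at[OF T(1-9)])
      then have "T = {v,j,l}" using only[OF T(10)] by simp
      then show False using T(11,12) by simp
    qed
    have pq: "p \<noteq> q" using q linked_irrefl by auto
    show False
    proof (cases "q \<in> {v,j,l}")
      case True
      obtain w where w: "linked q w" "w \<in> {v,j,l}" "w \<noteq> q"
        using True vjl linked_sym by auto
      have "w \<in> U" using w v vjl by auto
      have "p \<noteq> w" using p(2) w(2) by blast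
      then have "bad {q,p,w}" using bad_adjacent[of q p w] linked_sym[OF q(1)] w(1) by simp
      then show False
        by (rule no_bad[OF _ refl, of q p w w]) (use q p(1) pq w \<open>w \<in> U\<close> \<open>p \<noteq> w\<close> in simp_all)
    next
      case False
      have ne: "p \<noteq> v" "p \<noteq> j" "q \<noteq> v" "q \<noteq> j" using False p(2) by simp_all
      then have "bad {v,j,p} \<or> bad {v,j,q} \<or> bad {p,q,v} \<or> bad {p,q,j}"
        by (intro disjoint_links_bad vjl(1) q(1)) auto
      then show False
      proof (elim disjE)
        assume "bad {v,j,p}"
        then show False by (rule no_bad[OF _ refl, of v j p v]) (use ne v p vjl in simp_all)
      next
        assume "bad {v,j,q}"
        then show False by (rule no_bad'[OF _ refl, of v j q v]) (use ne v q vjl False in simp_all)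
      next
        assume "bad {p,q,v}"
        then show False by (rule no_bad[OF _ refl, of p q v v]) (use ne v p q vjl pq in simp_all)
      next
        assume "bad {p,q,j}"
        then show False by (rule no_bad[OF _ refl, of p q j j]) (use ne v p q vjl pq in simp_all)
      qed
    qed
  next
    case False
    \<comment> \<open>All degrees are 1, so there is no bad triple at all, whereas two distinct
      links in \<open>U\<close> always produce one.\<close>
    then have deg1: "card (nbrs U v) = 1" "bads_at U v = {}" if "v \<in> U" for v
      using deg[of v] lt[of v] that by auto
    have "U \<noteq> {}" using assms by auto
    then obtain v where v: "v \<in> U" by auto
    then obtain j where j: "linked v j" "j \<in> U" using nbr_ex by auto
    have "\<not> U \<subseteq> {v,j}" using assms card_mono[of "{v,j}" U] by (auto simp: card_insert_if split: if_splits)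
    then obtain p where p: "p \<in> U" "p \<notin> {v,j}" by auto
    obtain q where q: "linked p q" "q \<in> U" using nbr_ex[OF p(1)] by auto
    have no_bad: False if "bad {x,y,z}" "x \<noteq> y" "x \<noteq> z" "y \<noteq> z" "x \<in> U" "y \<in> U" "z \<in> U" for x y z
      using bad_in_bads_at[OF that(1) refl that(2-7), of x] deg1(2)[of x] that by auto
    have pq: "p \<noteq> q" "v \<noteq> j" using q j linked_irrefl by auto
    show False
    proof (cases "q = v \<or> q = j")
      case True
      then have "bad {v,p,j} \<or> bad {j,p,v}"
        using bad_adjacent[of v p j] bad_adjacent[of j p v] linked_sym[OF q(1)] j(1) linked_sym[OF j(1)] p(2)
        by blast
      then show False
        using no_bad[of v p j] no_bad[of j p v] p v j(2) pq by auto
    next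
      case False
      have ne: "p \<noteq> v" "p \<noteq> j" "q \<noteq> v" "q \<noteq> j" using False p(2) by simp_all
      then have "bad {v,j,p} \<or> bad {v,j,q} \<or> bad {p,q,v} \<or> bad {p,q,j}"
        by (intro disjoint_links_bad j(1) q(1)) auto
      then show False
        using no_bad[of v j p] no_bad[of v j q] no_bad[of p q v] no_bad[of p q j] ne pq v p(1) q(2) j(2)
        by argo
    qed
  qed
qed

lemma excess_le_2: "excess U \<le> 2"
proof (induction "card U" arbitrary: U rule: less_induct)
  case less
  show ?case
  proof (cases "card U \<le> 3")
    case True
    then show ?thesis using excess_card_3 by blast
  next
    case False
    then obtain v where v: "v \<in> U" "card (nbrs U v) \<le> card (bads_at U v)"
      using removable_vertex[of U] by auto
    have "card (U - {v}) < card U" using v by (intro card_Diff1_less) simp_all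
    then have "excess (U - {v}) \<le> 2" by (rule less)
    then show ?thesis using excess_remove[OF v(1)] v(2) by linarith
  qed
qed

subsection \<open>Families of excess 2\<close>

text \<open>The inequality \<open>n < (n choose 2) + 2\<close> holds for every \<open>n\<close>.
  When neighbours and bad triples at \<open>v\<close> are equally many, at most one bad triple at
  \<open>v\<close> can therefore contain a vertex not linked to \<open>v\<close>.\<close>

lemma bads_at_two_extra:
  assumes "v \<in> U" "S \<in> bads_at U v" "S' \<in> bads_at U v" "S \<noteq> S'"
    "\<not> S - {v} \<subseteq> nbrs U v" "\<not> S' - {v} \<subseteq> nbrs U v"
  shows "card (nbrs U v) < card (bads_at U v)"
proof -
  let ?I = "{T \<in> bads_at U v. T - {v} \<subseteq> nbrs U v}"
  let ?n = "card (nbrs U v)"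
  have "?n < (?n choose 2) + 2"
    using choose_two_less[of ?n] by (cases "?n choose 2 < ?n") (auto simp: choose_two)
  also have "\<dots> \<le> card ?I + card {S,S'}"
    using bads_at_choose[OF assms(1)] assms(4) by simp
  also have "\<dots> = card (?I \<union> {S,S'})"
    using assms(5,6) by (intro card_Un_disjoint[symmetric]) auto
  also have "\<dots> \<le> card (bads_at U v)" using assms(2,3) by (intro card_mono) auto
  finally show ?thesis .
qed

text \<open>All triples inside the clique are bad by \<open>bad_adjacent\<close>. Their number is 1
  = 3 - 2 or 4 = 6 - 2, which is the number of links minus the excess, so no other bad triple
  exists.\<close>

lemma bads_clique:
  assumes "excess U = 2" "K \<subseteq> U" "card K = 3 \<or> card K = 4" "links U = {e. e \<subseteq> K \<and> card e = 2}"
  shows "bads U = {T. T \<subseteq> K \<and> card T = 3}"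
proof -
  have "{T. T \<subseteq> K \<and> card T = 3} \<subseteq> bads U"
  proof
    fix T assume "T \<in> {T. T \<subseteq> K \<and> card T = 3}"
    then obtain x y z where T: "T = {x,y,z}" "x \<noteq> y" "x \<noteq> z" "y \<noteq> z" "T \<subseteq> K" "card T = 3"
      by (auto simp: card_3_iff)
    then have "{x,y} \<in> links U" "{x,z} \<in> links U" using assms(4) by auto
    then have "bad T" using bad_adjacent[of x y z] T by (simp add: links_pair)
    then show "T \<in> bads U" using T assms(2) by (auto simp: bads_def)
  qed
  moreover have "card (bads U) = card {T. T \<subseteq> K \<and> card T = 3}"
  proof -
    have "card (links U) = card K choose 2" using assms(4) n_subsets[of K 2] by simp
    moreover have "card {T. T \<subseteq> K \<and> card T = 3} = card K choose 3" using n_subsets[of K 3] by simp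
    moreover have "(3::nat) choose 2 = 3" "(3::nat) choose 3 = 1" "(4::nat) choose 2 = 6" "(4::nat) choose 3 = 4"
      by (simp_all add: numeral_eq_Suc)
    ultimately show ?thesis using assms(1,3) by (auto simp: excess_def)
  qed
  ultimately show ?thesis by (intro card_subset_eq[symmetric]) simp_all
qed

text \<open>If \<open>K\<close> contains both neighbours and non-neighbours of \<open>v\<close>, or
  if \<open>v\<close> has neighbours but none in \<open>K\<close>, two bad triples at
  \<open>v\<close> arise that contain non-neighbours of \<open>v\<close> in \<open>K\<close>,
  against \<open>bads_at_two_extra\<close>. If all of \<open>K\<close> is adjacent to
  \<open>v\<close>, then \<open>n choose 2 \<le> n\<close> bounds the degree \<open>n\<close> by
  3.\<close>

lemma clique_extend:
  assumes v: "v \<in> U" "card (nbrs U v) = card (bads_at U v)"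
    and ex: "excess (U - {v}) = 2" and K: "K \<subseteq> U - {v}" "card K = 3 \<or> card K = 4"
    and links: "links (U - {v}) = {e. e \<subseteq> K \<and> card e = 2}"
  shows "nbrs U v = {} \<or> (nbrs U v = K \<and> card K = 3)"
proof (rule ccontr)
  assume neg: "\<not> ?thesis"
  have bads: "bads (U - {v}) = {T. T \<subseteq> K \<and> card T = 3}"
    using bads_clique[OF ex K links] .
  have K_linked: "linked x y" if "x \<in> K" "y \<in> K" "x \<noteq> y" for x y
  proof -
    have "{x,y} \<in> links (U - {v})" using links that by auto
    then show ?thesis by (simp add: links_pair)
  qed
  have nbr: "linked v x" "linked x v" "x \<in> U" "x \<noteq> v" if "x \<in> nbrs U v" for x
    using that linked_sym linked_irrefl by (auto simp: nbrs_def)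
  have vK: "x \<in> U" "x \<noteq> v" if "x \<in> K" for x using that K by auto
  have no_two: False if "S \<in> bads_at U v" "S' \<in> bads_at U v" "S \<noteq> S'" "y \<in> S" "y' \<in> S'"
    "y \<in> K - nbrs U v" "y' \<in> K - nbrs U v" for S S' y y'
    using bads_at_two_extra[OF v(1) that(1-3)] v(2) that(4-7) vK by auto
  have mixed: "{v,x,y} \<in> bads_at U v" if "x \<in> K \<inter> nbrs U v" "y \<in> K - nbrs U v" for x y
  proof -
    have "x \<noteq> y" using that by auto
    then have "bad {x,v,y}" using bad_adjacent[of x v y] nbr[of x] K_linked[of x y] that vK[of y] by auto
    then have "bad {v,x,y}" by (simp add: insert_commute)
    then show ?thesis using vK that \<open>x \<noteq> y\<close> v(1) by (intro bad_in_bads_at[OF _ refl]) auto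
  qed
  consider (meet) "K \<inter> nbrs U v \<noteq> {}" "\<not> K \<subseteq> nbrs U v" | (sub) "K \<subseteq> nbrs U v"
    | (disj) "K \<inter> nbrs U v = {}" by blast
  then show False
  proof cases
    case meet
    then obtain x y where xy: "x \<in> K \<inter> nbrs U v" "y \<in> K - nbrs U v" by blast
    have "card {x,y} \<le> 2" by (simp add: card_insert_if)
    then have "\<not> K \<subseteq> {x,y}" using K(2) card_mono[of "{x,y}" K] by auto
    then obtain z where z: "z \<in> K" "z \<noteq> x" "z \<noteq> y" by auto
    show False
    proof (cases "z \<in> nbrs U v")
      case True
      then have "{v,x,y} \<noteq> {v,z,y}" using z vK xy by (auto simp: set_eq_iff)
      then show False using no_two[OF mixed[OF xy] mixed[of z y], of y y] True z xy by auto
    next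
      case False
      then have "{v,x,y} \<noteq> {v,x,z}" using z vK xy by (auto simp: set_eq_iff)
      then show False using no_two[OF mixed[OF xy] mixed[of x z], of y z] False z xy by auto
    qed
  next
    case sub
    have le: "card K \<le> card (nbrs U v)" using sub by (simp add: card_mono)
    have "card (nbrs U v) choose 2 \<le> card (bads_at U v)"
      using bads_at_choose[OF v(1)] by (rule order_trans) (rule card_mono, auto)
    then have le': "card (nbrs U v) * (card (nbrs U v) - 1) div 2 \<le> card (nbrs U v)"
      using v(2) by (simp add: choose_two)
    have "card (nbrs U v) \<le> 3"
    proof (rule ccontr)
      assume "\<not> card (nbrs U v) \<le> 3"
      then have "card (nbrs U v) * 3 \<le> card (nbrs U v) * (card (nbrs U v) - 1)"
        by (intro mult_le_mono) auto
      then have "card (nbrs U v) < 2" using le' by linarith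
      then show False using le K(2) by auto
    qed
    then have "card K = 3" "card (nbrs U v) = 3" using le K(2) by auto
    then have "nbrs U v = K" using card_subset_eq[of "nbrs U v" K] sub by simp
    then show False using neg \<open>card K = 3\<close> by simp
  next
    case disj
    obtain j where j: "j \<in> nbrs U v" using neg by blast
    have jK: "j \<notin> K" using j disj by auto
    \<comment> \<open>The links \<open>v\<close>, \<open>j\<close> and \<open>x\<close>,
      \<open>y\<close> are disjoint, and \<open>{x,y,j}\<close> is not bad because it is not inside
      \<open>K\<close>; so the bad triple of \<open>disjoint_links_bad\<close> passes through
      \<open>v\<close>. No single triple can serve all three pairs from three vertices of
      \<open>K\<close>, since it would have to miss \<open>K\<close>.\<close>
    have cross: "\<exists>S. S \<in> bads_at U v \<and> S \<inter> K \<noteq> {} \<and> S \<inter> K \<subseteq> {x,y}"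
      if xy: "x \<in> K" "y \<in> K" "x \<noteq> y" for x y
    proof -
      have ne: "j \<noteq> x" "j \<noteq> y" "v \<noteq> x" "v \<noteq> y" "v \<noteq> j" using jK xy vK nbr[OF j] by auto
      have "\<not> bad {x,y,j}"
      proof
        assume "bad {x,y,j}"
        then have "{x,y,j} \<in> bads (U - {v})" using xy vK nbr[OF j] ne by (auto simp: bads_def)
        then show False using bads jK by auto
      qed
      then have "bad {v,j,x} \<or> bad {v,j,y} \<or> bad {x,y,v}"
        using disjoint_links_bad[of v j x y] nbr(1)[OF j] K_linked[OF xy] ne by auto
      then have "{v,j,x} \<in> bads_at U v \<or> {v,j,y} \<in> bads_at U v \<or> {x,y,v} \<in> bads_at U v"
        using bad_in_bads_at[OF _ refl, of v j x U v] bad_in_bads_at[OF _ refl, of v j y U v]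
          bad_in_bads_at[OF _ refl, of x y v U v] ne xy vK nbr(3)[OF j] v(1) by auto
      moreover have "v \<notin> K" using vK by auto
      ultimately show ?thesis using jK xy by blast
    qed
    have "3 \<le> card K" using K(2) by auto
    then obtain x y z where xyz: "x \<in> K" "y \<in> K" "z \<in> K" "x \<noteq> y" "x \<noteq> z" "y \<noteq> z"
      by (rule three_distinct)
    obtain S1 where S1: "S1 \<in> bads_at U v" "S1 \<inter> K \<noteq> {}" "S1 \<inter> K \<subseteq> {x,y}"
      using cross xyz by meson
    obtain S2 where S2: "S2 \<in> bads_at U v" "S2 \<inter> K \<noteq> {}" "S2 \<inter> K \<subseteq> {x,z}"
      using cross xyz by meson
    obtain S3 where S3: "S3 \<in> bads_at U v" "S3 \<inter> K \<noteq> {}" "S3 \<inter> K \<subseteq> {y,z}"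
      using cross xyz by meson
    have "S1 \<noteq> S2 \<or> S1 \<noteq> S3" using S1 S2 S3 xyz by blast
    moreover have eq: "S = S'" if S: "S \<in> bads_at U v" "S \<inter> K \<noteq> {}" "S' \<in> bads_at U v" "S' \<inter> K \<noteq> {}" for S S'
    proof (rule ccontr)
      assume "S \<noteq> S'"
      moreover obtain y y' where "y \<in> S \<inter> K" "y' \<in> S' \<inter> K" using S(2,4) by blast
      ultimately show False using no_two[OF S(1,3), of y y'] disj by auto
    qed
    ultimately show False using S1 S2 S3 by metis
  qed
qed

text \<open>Deleting a removable vertex cannot lower the excess, which therefore stays 2, and
  \<open>clique_extend\<close> applies. Restoring the vertex leaves the links unchanged or completes
  a clique on three vertices to one on four.\<close>

lemma excess_eq_2:
  assumes "excess U = 2"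
  shows "\<exists>K\<subseteq>U. (card K = 3 \<or> card K = 4) \<and> links U = {e. e \<subseteq> K \<and> card e = 2}"
  using assms
proof (induction "card U" arbitrary: U rule: less_induct)
  case less
  show ?case
  proof (cases "card U \<le> 3")
    case True
    then show ?thesis using excess_card_3[of U] less.prems by (intro exI[of _ U]) simp
  next
    case False
    then obtain v where v: "v \<in> U" "card (nbrs U v) \<le> card (bads_at U v)"
      using removable_vertex[of U] by auto
    have ex: "excess (U - {v}) = 2" and eq: "card (nbrs U v) = card (bads_at U v)"
      using excess_remove[OF v(1)] v(2) less.prems excess_le_2[of "U - {v}"] by linarith+
    have "card (U - {v}) < card U" using v by (intro card_Diff1_less) simp_all
    from less.hyps[OF this ex] obtain K where "K \<subseteq> U - {v} \<and> (card K = 3 \<or> card K = 4) \<and>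
      links (U - {v}) = {e. e \<subseteq> K \<and> card e = 2}" by (elim exE)
    then have K: "K \<subseteq> U - {v}" "card K = 3 \<or> card K = 4"
      and links: "links (U - {v}) = {e. e \<subseteq> K \<and> card e = 2}" by simp_all
    consider "nbrs U v = {}" | "nbrs U v = K" "card K = 3"
      using clique_extend[OF v(1) eq ex K links] by blast
    then show ?thesis
    proof cases
      case 1
      then have "links U = {e. e \<subseteq> K \<and> card e = 2}" using links_remove[OF v(1)] links by simp
      moreover have "K \<subseteq> U" using K(1) by auto
      ultimately show ?thesis using K(2) by (intro exI[of _ K]) simp
    next
      case 2
      have vK: "v \<notin> K" using K by auto
      have "links U = {e. e \<subseteq> insert v K \<and> card e = 2}"
      proof (intro equalityI subsetI)
        fix e assume "e \<in> links U"
        then show "e \<in> {e. e \<subseteq> insert v K \<and> card e = 2}"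
          using links_remove[OF v(1)] links 2 vK by (auto simp: card_insert_if)
      next
        fix e assume e: "e \<in> {e. e \<subseteq> insert v K \<and> card e = 2}"
        show "e \<in> links U"
        proof (cases "v \<in> e")
          case True
          then obtain u where "e = {v,u}" "u \<noteq> v" using e by (auto simp: card_2_iff)
          then show ?thesis using links_remove[OF v(1)] 2 e by auto
        next
          case False
          then show ?thesis using links_remove[OF v(1)] links e by auto
        qed
      qed
      moreover have "insert v K \<subseteq> U" "card (insert v K) = 4" using K v 2 vK by auto
      ultimately show ?thesis by (intro exI[of _ "insert v K"]) simp
    qed
  qed
qed

section \<open>Number of centres and structure of extremal families\<close>

lemma links_UNIV: "links UNIV = (\<Union>T\<in>{T. card T = 3}. {e. e \<subseteq> F T \<and> card e = 2})"
proof (intro equalityI subsetI)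
  fix e assume "e \<in> links UNIV"
  then obtain i j where e: "e = {i,j}" "linked i j" "i \<noteq> j" by (auto elim: linksE)
  obtain k where k: "k \<noteq> i" "k \<noteq> j" "i \<in> F {i,j,k}" "j \<in> F {i,j,k}" using linkedE[OF e(2)] by metis
  then have "card {i,j,k} = 3" "e \<subseteq> F {i,j,k} \<and> card e = 2" using e by simp_all
  then show "e \<in> (\<Union>T\<in>{T. card T = 3}. {e. e \<subseteq> F T \<and> card e = 2})" by blast
next
  fix e assume "e \<in> (\<Union>T\<in>{T. card T = 3}. {e. e \<subseteq> F T \<and> card e = 2})"
  then obtain T i j where T: "card T = 3" "e = {i,j}" "i \<noteq> j" "i \<in> F T" "j \<in> F T" by (auto simp: card_2_iff)
  then have ij: "i \<in> T" "j \<in> T" using centre_subset by auto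
  obtain k where k: "T = {i,j,k}" "k \<noteq> i" "k \<noteq> j" using triple_pairE[OF T(1) ij T(3)] .
  have "linked i j" unfolding linked_def using T k by auto
  then show "e \<in> links UNIV" using T by (simp add: links_pair)
qed

lemma centre_pair_unique:
  assumes "card T = 3" "card S = 3" "i \<noteq> j" "i \<in> F T" "j \<in> F T" "i \<in> F S" "j \<in> F S"
  shows "T = S"
proof -
  have "i \<in> T" "j \<in> T" "i \<in> S" "j \<in> S" using assms centre_subset by auto
  obtain k where k: "T = {i,j,k}" "k \<noteq> i" "k \<noteq> j"
    using triple_pairE[OF assms(1) \<open>i \<in> T\<close> \<open>j \<in> T\<close> assms(3)] .
  obtain l where l: "S = {i,j,l}" "l \<noteq> i" "l \<noteq> j"
    using triple_pairE[OF assms(2) \<open>i \<in> S\<close> \<open>j \<in> S\<close> assms(3)] .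
  show ?thesis using centre_unique[of i j k l] k l assms by auto
qed

text \<open>By \<open>centre_pair_unique\<close> each link is a pair of centres of exactly one
  triple, so the links can be counted triple by triple; the identity \<open>pt\<close> is then
  summed.\<close>

lemma sum_card_centres:
  "int (\<Sum>T | card T = 3. card (F T)) = int (CARD('a) choose 3) + excess UNIV"
proof -
  let ?Ts = "{T::'a set. card T = 3}"
  have "card (links UNIV) = (\<Sum>T\<in>?Ts. card {e. e \<subseteq> F T \<and> card e = 2})"
    unfolding links_UNIV
  proof (rule card_UN_disjoint)
    show "\<forall>T\<in>?Ts. \<forall>S\<in>?Ts. T \<noteq> S \<longrightarrow>
      {e. e \<subseteq> F T \<and> card e = 2} \<inter> {e. e \<subseteq> F S \<and> card e = 2} = {}"
    proof (intro ballI impI equals0I)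
      fix T S e assume TS: "T \<in> ?Ts" "S \<in> ?Ts" "T \<noteq> S"
        and "e \<in> {e. e \<subseteq> F T \<and> card e = 2} \<inter> {e. e \<subseteq> F S \<and> card e = 2}"
      then obtain i j where "i \<noteq> j" "i \<in> F T" "j \<in> F T" "i \<in> F S" "j \<in> F S" by (auto simp: card_2_iff)
      then show False using centre_pair_unique[of T S i j] TS by simp
    qed
  qed simp_all
  also have "\<dots> = (\<Sum>T\<in>?Ts. card (F T) choose 2)" by (simp add: n_subsets)
  finally have l: "card (links UNIV) = (\<Sum>T\<in>?Ts. card (F T) choose 2)" .
  have "bads UNIV = {T \<in> ?Ts. bad T}" by (auto simp: bads_def)
  then have b: "card (bads UNIV) = (\<Sum>T\<in>?Ts. if bad T then 1 else 0)"
    by (simp add: sum.If_cases Int_def)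
  have "card ?Ts = CARD('a) choose 3" using n_subsets[of "UNIV :: 'a set" 3] by simp
  then have t: "CARD('a) choose 3 = (\<Sum>T\<in>?Ts. 1)" by simp
  have pt: "card (F T) + (if bad T then 1 else 0) = 1 + (card (F T) choose 2)" if "card T = 3" for T
  proof -
    have "bad T \<longleftrightarrow> card (F T) = 0 \<or> card (F T) = 3"
      using that centre_subset[of T] card_subset_eq[of T "F T"] by (auto simp: bad_def)
    moreover have "card (F T) \<le> 3" using card_mono[of T "F T"] centre_subset that by simp
    then have "card (F T) = 0 \<or> card (F T) = 1 \<or> card (F T) = 2 \<or> card (F T) = 3" by linarith
    ultimately show ?thesis by (elim disjE) (auto simp: choose_two)
  qed
  have "(\<Sum>T\<in>?Ts. card (F T) + (if bad T then 1 else 0)) = (\<Sum>T\<in>?Ts. 1 + (card (F T) choose 2))"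
    using pt by (intro sum.cong) auto
  then have "(\<Sum>T\<in>?Ts. card (F T)) + card (bads UNIV) = (CARD('a) choose 3) + card (links UNIV)"
    unfolding sum.distrib b l t .
  then show ?thesis unfolding excess_def by linarith
qed

text \<open>The part of an extremal family that is not a linear order: three vertices all of whose
  vectors occur, or four or five vertices where exactly the vectors with positive entry at \<^term>\<open>e\<close> occur.\<close>

definition core :: "'a set \<Rightarrow> 'a \<Rightarrow> bool" where
  "core Q e \<longleftrightarrow> e \<in> Q \<and> card Q \<in> {3,4,5} \<and>
    (\<forall>T\<subseteq>Q. card T = 3 \<longrightarrow> F T = (if e \<notin> T then {} else if card Q = 3 then T else T - {e})) \<and>
    (\<forall>l q q'. l \<notin> Q \<longrightarrow> q \<in> Q \<longrightarrow> q' \<in> Q \<longrightarrow> q \<noteq> q' \<longrightarrow> F {l,q,q'} = {l}) \<and>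
    (\<forall>T. card T = 3 \<longrightarrow> \<not> T \<subseteq> Q \<longrightarrow> card (F T) = 1)"

text \<open>If some triple inside the clique \<open>K\<close> consists of centres, then
  \<open>K\<close> equals that triple and is the core, with any of its vertices as \<open>e\<close>.
  Otherwise triples inside \<open>K\<close> have no centres, one vertex \<open>d\<close> outside
  \<open>K\<close> completes every link to its triple, and the core is \<open>insert d K\<close>
  with \<open>e = d\<close>.\<close>

lemma core_exists:
  assumes "excess UNIV = 2"
  shows "\<exists>Q e. core Q e"
proof -
  obtain K where K: "card K = 3 \<or> card K = 4" "links UNIV = {e. e \<subseteq> K \<and> card e = 2}"
    using excess_eq_2[OF assms] by (elim exE conjE) simp
  have bads: "bads UNIV = {T. T \<subseteq> K \<and> card T = 3}" using bads_clique[OF assms _ K] by simp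
  have bad: "bad T \<longleftrightarrow> T \<subseteq> K" if "card T = 3" for T
  proof -
    have "bad T \<longleftrightarrow> T \<in> bads UNIV" using that by (simp add: bads_def)
    then show ?thesis using bads that by simp
  qed
  have linked: "linked i j \<longleftrightarrow> i \<noteq> j \<and> i \<in> K \<and> j \<in> K" for i j
  proof -
    have "linked i j \<longleftrightarrow> {i,j} \<in> links UNIV" by (simp add: links_pair)
    then show ?thesis using K(2) by (auto simp: card_insert_if)
  qed
  have outer_pair: "F {i,j,l} = {l} \<or> F {i,j,l} = {i,j}"
    if "i \<in> K" "j \<in> K" "i \<noteq> j" "l \<notin> K" for i j l
  proof (rule not_bad_cases)
    show "linked i j" using that linked by simp
    show "l \<notin> {i,j}" using that by auto
    have "card {i,j,l} = 3" using that by (auto simp: card_insert_if)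
    then show "\<not> bad {i,j,l}" using bad that by simp
  qed
  have K3: "3 \<le> card K" using K(1) by auto
  show ?thesis
  proof (cases "\<exists>T\<subseteq>K. card T = 3 \<and> F T = T")
    case True
    then obtain T where T: "T \<subseteq> K" "card T = 3" "F T = T" by auto
    then obtain a b c where abc: "T = {a,b,c}" "a \<noteq> b" "a \<noteq> c" "b \<noteq> c" by (auto simp: card_3_iff)
    have inK: "a \<in> K" "b \<in> K" "c \<in> K" using abc T by auto
    have "K = T"
    proof (rule ccontr)
      assume "K \<noteq> T"
      then obtain w where w: "w \<in> K" "w \<notin> T" using T by auto
      have other: "F {x,y,w} = {}" if xy: "x \<in> T" "y \<in> T" "x \<noteq> y" for x y
      proof -
        obtain z where z: "T = {x,y,z}" "z \<noteq> x" "z \<noteq> y" using triple_pairE[OF T(2) xy] .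
        have c3: "card {x,y,w} = 3" using xy w by (auto simp: card_insert_if)
        then have "bad {x,y,w}" using bad xy T(1) w by auto
        moreover have "x \<notin> F {x,y,w}"
        proof
          assume "x \<in> F {x,y,w}"
          moreover have "y \<in> F {x,y,z}" using T(3) z xy by auto
          ultimately have "w = z" using centre_unique[of x y w z] xy w z by auto
          then show False using w z by auto
        qed
        ultimately show ?thesis by (auto simp: bad_def)
      qed
      \<comment> \<open>The link \<open>a\<close>, \<open>w\<close> is carried by a triple with
        third vertex \<open>k\<close>. Inside \<open>K\<close> this \<open>k\<close> would be a
        fifth element; outside, \<open>k\<close> becomes a centre of \<open>{a,b,k}\<close> and
        uniqueness gives \<open>b = w\<close>.\<close>
      have "linked a w" using linked inK w abc by auto
      then obtain k where k: "k \<noteq> a" "k \<noteq> w" "a \<in> F {a,w,k}" "w \<in> F {a,w,k}" using linkedE by metis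
      have kK: "k \<notin> K"
      proof
        assume "k \<in> K"
        have "card {a,w,k} = 3" using k w abc by (auto simp: card_insert_if)
        then have "bad {a,w,k}" using bad inK w \<open>k \<in> K\<close> by simp
        then have full: "F {a,w,k} = {a,w,k}" using k by (auto simp: bad_def)
        have "k \<notin> T"
        proof
          assume "k \<in> T"
          then have "F {a,k,w} = {}" using other[of a k] k abc by auto
          then show False using k by (simp add: insert_commute)
        qed
        then have "card {a,b,c,w,k} \<le> card K" using w \<open>k \<in> K\<close> inK by (intro card_mono) auto
        moreover have "card {a,b,c,w,k} = 5" using w \<open>k \<notin> T\<close> abc k by auto
        ultimately show False using K(1) by auto
      qed
      have "F {a,b,k} = {k} \<or> F {a,b,k} = {a,b}" using outer_pair inK kK abc by simp
      moreover have "a \<notin> F {a,b,k}"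
        using centre_unique[of a b k c] T(3) abc kK inK by auto
      ultimately have "k \<in> F {k,a,b}" by (auto simp: insert_commute)
      moreover have "a \<in> F {a,k,w}" using k by (simp add: insert_commute)
      ultimately have "b = w" using centre_unique[of k a b w] kK inK w k abc by (auto simp: insert_commute)
      then show False using w abc by auto
    qed
    have 1: "F S = S" if "S \<subseteq> K" "card S = 3" for S
      using card_subset_eq[of K S] that T \<open>K = T\<close> by simp
    have 2: "F {l,q,q'} = {l}" if lq: "l \<notin> K" "q \<in> K" "q' \<in> K" "q \<noteq> q'" for l q q'
    proof -
      obtain z where z: "K = {q,q',z}" "z \<noteq> q" "z \<noteq> q'"
        using triple_pairE[OF _ lq(2-4)] T(2) \<open>K = T\<close> by metis
      have "q \<notin> F {q,q',l}"
        using centre_unique[of q q' l z] T(3) \<open>K = T\<close> z lq by auto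
      then have "F {q,q',l} = {l}" using outer_pair[of q q' l] lq by auto
      then show ?thesis by (simp add: insert_commute)
    qed
    have 3: "card (F S) = 1" if S: "card S = 3" "\<not> S \<subseteq> K" for S
    proof (rule ccontr)
      assume "card (F S) \<noteq> 1"
      moreover have "F S \<noteq> {}" "F S \<noteq> S" using bad S by (auto simp: bad_def)
      moreover have "card (F S) \<noteq> 0" using \<open>F S \<noteq> {}\<close> by simp
      ultimately have "\<not> card (F S) \<le> Suc 0" by linarith
      then obtain i j where ij: "i \<in> F S" "j \<in> F S" "i \<noteq> j" by (auto simp: card_le_Suc0_iff_eq)
      obtain k where k: "S = {i,j,k}" "k \<noteq> i" "k \<noteq> j"
        using triple_pairE[OF S(1) _ _ ij(3)] ij centre_subset by blast
      have "linked i j" unfolding linked_def using ij k by auto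
      then have "i \<in> K" "j \<in> K" using linked by auto
      then have "S = K" using centre_pair_unique[OF S(1), of K i j] ij T \<open>K = T\<close> by simp
      then show False using S by simp
    qed
    have "a \<in> S" if "S \<subseteq> K" "card S = 3" for S
      using card_subset_eq[of K S] that T \<open>K = T\<close> inK by simp
    then have "F S = (if a \<notin> S then {} else if card K = 3 then S else S - {a})"
      if "S \<subseteq> K" "card S = 3" for S using 1[OF that] that T \<open>K = T\<close> by simp
    then have "core K a" unfolding core_def using inK 2 3 T \<open>K = T\<close> by simp
    then show ?thesis by blast
  next
    case False
    have empty: "F T = {}" if "T \<subseteq> K" "card T = 3" for T
      using bad[of T] that False by (auto simp: bad_def)
    obtain a b where ab: "a \<in> K" "b \<in> K" "a \<noteq> b" using three_distinct[OF K3] by metis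
    then have "linked a b" using linked by simp
    then obtain d where d: "d \<noteq> a" "d \<noteq> b" "a \<in> F {a,b,d}" "b \<in> F {a,b,d}" using linkedE by metis
    have dK: "d \<notin> K"
    proof
      assume "d \<in> K"
      then have "F {a,b,d} = {}" using ab d by (intro empty) auto
      then show False using d by simp
    qed
    \<comment> \<open>Of two different triples \<open>{x,y,d}\<close> and \<open>{y,z,d}\<close>,
      one cannot have \<open>y\<close> as a centre while the other has \<open>d\<close>. Hence the
      centres found for one pair of \<open>K\<close> propagate to every pair sharing a vertex with
      it.\<close>
    have step: "F {y,z,d} = {y,z}" if xyz: "x \<in> K" "y \<in> K" "z \<in> K" "x \<noteq> y" "y \<noteq> z" "F {x,y,d} = {x,y}" for x y z
    proof (cases "x = z")
      case True
      then show ?thesis using xyz by (simp add: insert_commute)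
    next
      case False
      have "d \<notin> F {y,z,d}"
      proof
        assume "d \<in> F {y,z,d}"
        moreover have "{y,z,d} = {d,y,z}" "{x,y,d} = {d,y,x}" by auto
        ultimately have "d \<in> F {d,y,z}" "y \<in> F {d,y,x}" using xyz(6) by auto
        from centre_unique[OF this] have "z = x" using xyz(1-5) dK by blast
        then show False using False by simp
      qed
      then show ?thesis using outer_pair[of y z d] xyz dK by auto
    qed
    have abd: "F {a,b,d} = {a,b}" using outer_pair[of a b d] ab dK d by auto
    have apex: "F {x,y,d} = {x,y}" if "x \<in> K" "y \<in> K" "x \<noteq> y" for x y
    proof (cases "x = b")
      case True
      then show ?thesis using step[OF ab(1) ab(2) _ ab(3) _ abd] that by simp
    next
      case False
      then have "F {b,x,d} = {b,x}" using step[OF ab(1) ab(2) _ ab(3) _ abd] that by simp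
      then show ?thesis using step[of b x y] that False ab by simp
    qed
    let ?Q = "insert d K"
    have 1: "F S = (if d \<notin> S then {} else S - {d})" if S: "S \<subseteq> ?Q" "card S = 3" for S
    proof (cases "d \<in> S")
      case True
      have "card (S - {d}) = 2" using True S by simp
      then obtain x y where xy: "S - {d} = {x,y}" "x \<noteq> y" by (auto simp: card_2_iff)
      then have "S = {x,y,d}" "x \<in> K" "y \<in> K" using True S by auto
      then show ?thesis using apex xy by simp
    next
      case False
      then show ?thesis using empty S by (auto simp: subset_insert)
    qed
    have 2: "F {l,q,q'} = {l}" if "l \<notin> ?Q" "q \<in> K" "q' \<in> K" "q \<noteq> q'" for l q q'
    proof -
      have "q \<notin> F {q,q',l}"
        using centre_unique[of q q' l d] apex[of q q'] that dK by auto
      then have "F {q,q',l} = {l}" using outer_pair[of q q' l] that by auto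
      then show ?thesis by (simp add: insert_commute)
    qed
    \<comment> \<open>A second clique vertex \<open>q'\<close> serves as pivot: \<open>l\<close> is
      the centre of \<open>{l,q,q'}\<close>, which excludes \<open>q\<close>, and \<open>q\<close>
      is a centre of \<open>{q,q',d}\<close>, which excludes \<open>d\<close>.\<close>
    have 4: "F {l,q,d} = {l}" if l: "l \<notin> ?Q" "q \<in> K" for l q
    proof -
      have "\<not> K \<subseteq> {q}" using K3 card_mono[of "{q}" K] by auto
      then obtain q' where q': "q' \<in> K" "q' \<noteq> q" by auto
      have ne: "l \<noteq> q" "l \<noteq> q'" "l \<noteq> d" "d \<noteq> q" "d \<noteq> q'" using l q' dK by auto
      have "q \<notin> F {q,l,d}"
      proof
        assume "q \<in> F {q,l,d}"
        moreover have "{l,q,q'} = {q,l,q'}" by auto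
        then have "l \<in> F {q,l,q'}" using 2[of l q q'] l q' by auto
        ultimately have "d = q'" using ne q' by (intro centre_unique[of q l d q']) auto
        then show False using ne by simp
      qed
      moreover have "d \<notin> F {q,l,d}"
      proof
        assume "d \<in> F {q,l,d}"
        moreover have "{q,l,d} = {d,q,l}" "{q,q',d} = {d,q,q'}" by auto
        ultimately have "d \<in> F {d,q,l}" "q \<in> F {d,q,q'}" using apex[of q q'] l q' by auto
        from centre_unique[OF this] show False using ne q' by blast
      qed
      moreover have "\<not> bad {q,l,d}" using bad[of "{q,l,d}"] ne dK by simp
      ultimately have "F {q,l,d} = {l}" using centre_subset[of "{q,l,d}"] by (auto simp: bad_def)
      then show ?thesis by (simp add: insert_commute)
    qed
    \<comment> \<open>Two centres of \<open>S\<close> would be linked, hence in \<open>K\<close>,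
      and the only triple carrying that link has third vertex \<open>d\<close>.\<close>
    have 3: "card (F S) = 1" if S: "card S = 3" "\<not> S \<subseteq> ?Q" for S
    proof (rule ccontr)
      assume "card (F S) \<noteq> 1"
      moreover have "F S \<noteq> {}" using bad S by (auto simp: bad_def)
      moreover have "card (F S) \<noteq> 0" using \<open>F S \<noteq> {}\<close> by simp
      ultimately have "\<not> card (F S) \<le> Suc 0" by linarith
      then obtain i j where ij: "i \<in> F S" "j \<in> F S" "i \<noteq> j" by (auto simp: card_le_Suc0_iff_eq)
      obtain k where k: "S = {i,j,k}" "k \<noteq> i" "k \<noteq> j"
        using triple_pairE[OF S(1) _ _ ij(3)] ij centre_subset by blast
      have "linked i j" unfolding linked_def using ij k by auto
      then have ijK: "i \<in> K" "j \<in> K" using linked by auto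
      then have "card {i,j,d} = 3" using dK ij by (auto simp: card_insert_if)
      then have "S = {i,j,d}" using centre_pair_unique[OF S(1), of "{i,j,d}" i j] ij apex[OF ijK] by simp
      then show False using S ijK by simp
    qed
    have "card ?Q = 4 \<or> card ?Q = 5" using K(1) dK by auto
    then have "core ?Q d" unfolding core_def
      using 1 2 4 3 by (auto simp: insert_commute)
    then show ?thesis by blast
  qed
qed

end

text \<open>In terms of positions \<^term>\<open>r\<close>, the first disjunct describes \<open>S(1) \<union> \<dots> \<union> S(c)\<close> and the
  second one \<open>T(s)\<close>.\<close>

definition ranked :: "nat \<Rightarrow> nat \<Rightarrow> ('a \<Rightarrow> nat) \<Rightarrow> 'a set \<Rightarrow> 'a set" where
  "ranked s c r T = {i \<in> T. (r i \<le> c \<and> (\<forall>x\<in>T. r i \<le> r x)) \<or>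
    (r i \<noteq> s \<and> (\<exists>y\<in>T. r y = s) \<and> (\<forall>x\<in>T. s \<le> r x))}"

lemma ranked_cong: "(\<And>x. x \<in> T \<Longrightarrow> r x = r' x) \<Longrightarrow> ranked s c r T = ranked s c r' T"
  by (auto simp: ranked_def)

section \<open>Ranking the vertices of an extremal family\<close>

context centre_family
begin

text \<open>The first element of \<open>U - Q\<close> in the tournament \<open>R\<close> beats every
  other outside vertex, and by \<open>core\<close> it is the only centre over two core vertices; so
  it is the only centre of each of its triples.\<close>

lemma core_dominating:
  assumes core: "core Q e" and U: "Q \<subset> U"
  shows "\<exists>m\<in>U - Q. \<forall>T\<subseteq>U. card T = 3 \<longrightarrow> m \<in> T \<longrightarrow> F T = {m}"
proof -
  have eQ: "e \<in> Q" and cQ: "card Q \<ge> 3" using core by (auto simp: core_def)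
  have out: "F {l,q,q'} = {l}" if "l \<notin> Q" "q \<in> Q" "q' \<in> Q" "q \<noteq> q'" for l q q'
    using core that by (auto simp: core_def)
  have one: "card (F T) = 1" if "card T = 3" "\<not> T \<subseteq> Q" for T
    using core that by (auto simp: core_def)
  \<comment> \<open>The remaining possibility, centre \<open>q\<close>, conflicts with
    \<open>l\<close> being the centre of \<open>{l,q,q'}\<close> for another core vertex
    \<open>q'\<close>.\<close>
  have out_mixed: "F {l,m,q} = {l} \<or> F {l,m,q} = {m}" if l: "l \<notin> Q" "m \<notin> Q" "l \<noteq> m" "q \<in> Q" for l m q
  proof -
    have ne: "l \<noteq> q" "m \<noteq> q" using l by auto
    then have "card {l,m,q} = 3" using l by simp
    then have "card (F {l,m,q}) = 1" using one l by simp
    then obtain z where z: "F {l,m,q} = {z}" by (auto simp: card_1_singleton_iff)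
    then have "z \<in> {l,m,q}" using centre_subset[of "{l,m,q}"] by auto
    moreover have "z \<noteq> q"
    proof
      assume "z = q"
      have "\<not> Q \<subseteq> {q}" using cQ card_mono[of "{q}" Q] by auto
      then obtain q' where q': "q' \<in> Q" "q' \<noteq> q" by auto
      have "{l,m,q} = {l,q,m}" by auto
      then have "q \<in> F {q,l,m}" using z \<open>z = q\<close> by (simp add: insert_commute)
      moreover have "{l,q,q'} = {q,l,q'}" by auto
      then have "l \<in> F {q,l,q'}" using out[of l q q'] l q' by auto
      ultimately have "m = q'" using ne l q' by (intro centre_unique[of q l m q']) auto
      then show False using q' l by simp
    qed
    ultimately show ?thesis using z by auto
  qed
  \<comment> \<open>On the vertices outside the core the centres form a transitive tournament.\<close>
  define R where "R l m \<longleftrightarrow> l \<noteq> m \<and> F {l,m,e} = {l}" for l m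
  have total: "R l m \<or> R m l" if "l \<notin> Q" "m \<notin> Q" "l \<noteq> m" for l m
    using out_mixed[OF that eQ] that by (auto simp: R_def insert_commute)
  have asym: "\<not> R m l" if "R l m" for l m
    using that by (auto simp: R_def insert_commute)
  \<comment> \<open>The reference vertex \<open>e\<close> in \<open>R\<close> is immaterial: a
    vertex that loses over \<open>e\<close> is not a centre over any other third vertex.\<close>
  have no: "m \<notin> F {l,m,x}" if "R l m" "l \<notin> Q" "m \<notin> Q" "x \<noteq> l" "x \<noteq> m" for l m x
  proof
    assume "m \<in> F {l,m,x}"
    then have "m \<in> F {m,l,x}" by (simp add: insert_commute)
    moreover have "{l,m,e} = {m,l,e}" by auto
    then have "l \<in> F {m,l,e}" using that by (auto simp: R_def)
    ultimately have "x = e" using that eQ by (intro centre_unique[of m l x e]) (auto simp: R_def)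
    then show False using \<open>m \<in> F {l,m,x}\<close> that by (auto simp: R_def)
  qed
  have trans: "R l x" if R: "R l m" "R m x" and Q: "l \<notin> Q" "m \<notin> Q" "x \<notin> Q" for l m x
  proof -
    have ne: "l \<noteq> m" "m \<noteq> x" "l \<noteq> x" using R asym by (auto simp: R_def)
    have "card {l,m,x} = 3" using ne by simp
    then have "card (F {l,m,x}) = 1" using one Q by simp
    then obtain z where z: "F {l,m,x} = {z}" by (auto simp: card_1_singleton_iff)
    have "m \<notin> F {l,m,x}" using no[OF R(1) Q(1,2)] ne by simp
    moreover have "x \<notin> F {l,m,x}" using no[OF R(2) Q(2,3), of l] ne by (simp add: insert_commute)
    ultimately have "z = l" using z centre_subset[of "{l,m,x}"] by auto
    then have "l \<in> F {x,l,m}" using z by (simp add: insert_commute)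
    have "\<not> R x l"
    proof
      assume "R x l"
      then have "l \<notin> F {x,l,m}" using no[OF _ Q(3,1), of m] ne by simp
      then show False using \<open>l \<in> F {x,l,m}\<close> by simp
    qed
    then show ?thesis using total Q ne by blast
  qed
  have "\<exists>m\<in>U - Q. \<forall>x\<in>U - Q. x \<noteq> m \<longrightarrow> \<not> R x m"
  proof (rule Finite_Set.bex_min_element)
    show "asymp_on (U - Q) R" using asym by (auto intro: asymp_onI)
    show "transp_on (U - Q) R" using trans by (auto intro!: transp_onI)
    show "U - Q \<noteq> {}" using U by auto
  qed simp
  then obtain m where m: "m \<in> U - Q" "\<And>x. x \<in> U - Q \<Longrightarrow> x \<noteq> m \<Longrightarrow> R m x"
    using total by (metis DiffD2)
  have "F T = {m}" if T: "T \<subseteq> U" "card T = 3" "m \<in> T" for T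
  proof -
    have notin: "x \<notin> F T" if x: "x \<in> T" "x \<noteq> m" for x
    proof -
      obtain y where y: "T = {m,x,y}" "y \<noteq> m" "y \<noteq> x" using triple_pairE[OF T(2,3) x(1)] x(2) by metis
      show ?thesis
      proof (cases "x \<in> Q")
        case False
        then have "R m x" using m x T by auto
        then show ?thesis using no[of m x y] m y False by auto
      next
        case xQ: True
        show ?thesis
        proof (cases "y \<in> Q")
          case True
          then show ?thesis using out[of m x y] m y xQ by auto
        next
          case False
          then have "F {m,y,x} = {m} \<or> F {m,y,x} = {y}" using out_mixed[of m y x] m y xQ by auto
          moreover have "x \<noteq> y" using False xQ by auto
          moreover have "T = {m,y,x}" using y by auto
          ultimately show ?thesis using x by auto
        qed
      qed
    qed
    have "card (F T) = 1" using one T m by auto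
    then obtain z where "F T = {z}" by (auto simp: card_1_singleton_iff)
    moreover from this have "z \<in> T" using centre_subset[of T] by auto
    ultimately show ?thesis using notin by auto
  qed
  then show ?thesis using m(1) by blast
qed

text \<open>The vertex \<open>e\<close> takes the first position \<open>s\<close> and the rest of
  the core follows in any order. The cutoff decides whether \<open>e\<close> is a centre:
  \<open>c = s\<close> admits it for three vertices, \<open>c = s - 1\<close> excludes it for four
  or five. The other centres come from the second disjunct of \<open>ranked\<close>.\<close>

lemma core_ranking_base:
  assumes core: "core Q e"
    and s: "s + card Q = Suc n" "0 < s" and c: "c = (if card Q = 3 then s else s - 1)"
  shows "\<exists>r. bij_betw r Q {s..n} \<and> (\<forall>T\<subseteq>Q. card T = 3 \<longrightarrow> F T = ranked s c r T)"
proof -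
  have eQ: "e \<in> Q" and cQ: "card Q \<in> {3,4,5}" using core by (auto simp: core_def)
  have inner: "F T = (if e \<notin> T then {} else if card Q = 3 then T else T - {e})"
    if "T \<subseteq> Q" "card T = 3" for T
    using core that by (auto simp: core_def)
  have "card (Q - {e}) = card {Suc s..n}" using eQ s by simp
  then obtain h where h: "bij_betw h (Q - {e}) {Suc s..n}"
    using finite_same_card_bij[of "Q - {e}" "{Suc s..n}"] by auto
  define r where "r = h(e := s)"
  have "bij_betw r (Q - {e}) {Suc s..n}" using h by (simp add: r_def bij_betw_def inj_on_def)
  then have "bij_betw r ((Q - {e}) \<union> {e}) ({Suc s..n} \<union> {s})"
    by (rule bij_betw_combine) (auto simp: r_def)
  moreover have "(Q - {e}) \<union> {e} = Q" "{Suc s..n} \<union> {s} = {s..n}" using eQ s cQ by auto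
  ultimately have bij: "bij_betw r Q {s..n}" by simp
  have re: "r e = s" by (simp add: r_def)
  have gt: "s < r x" if "x \<in> Q" "x \<noteq> e" for x
  proof -
    have "h x \<in> {Suc s..n}" using h that by (auto simp: bij_betw_def)
    then show ?thesis using that by (simp add: r_def)
  qed
  have ge: "s \<le> r x" if "x \<in> Q" for x using gt[OF that] re by (cases "x = e") auto
  have "F T = ranked s c r T" if T: "T \<subseteq> Q" "card T = 3" for T
  proof -
    have req: "r x = s \<longleftrightarrow> x = e" if "x \<in> T" for x
      using gt[of x] re that T(1) by (metis less_irrefl subsetD)
    have low: "r i \<le> c \<longleftrightarrow> card Q = 3 \<and> i = e" if "i \<in> T" for i
    proof (cases "i = e")
      case True
      then show ?thesis using re c s(2) by auto
    next
      case False
      then show ?thesis using gt[of i] c that T by (auto split: if_splits)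
    qed
    have "ranked s c r T = {i \<in> T. (card Q = 3 \<and> i = e) \<or> (i \<noteq> e \<and> e \<in> T)}"
      using low req ge T re by (auto simp: ranked_def)
    then show ?thesis using inner[OF T] by auto
  qed
  then show ?thesis using bij by blast
qed

text \<open>Induction on the vertex set: a dominating vertex is put in front of all others. Its
  position is below \<open>s\<close> and at most \<open>c\<close>, so \<open>ranked\<close> makes it
  the only centre of its triples.\<close>

lemma core_ranking:
  assumes core: "core Q e" and n: "n = CARD('a)"
    and s: "s + card Q = Suc n" and c: "c = (if card Q = 3 then s else s - 1)" and "0 < s"
  shows "\<exists>r. bij_betw r UNIV {1..n} \<and> (\<forall>T. card T = 3 \<longrightarrow> F T = ranked s c r T)"
proof -
  have *: "\<exists>r. bij_betw r U {Suc n - card U..n} \<and> (\<forall>T\<subseteq>U. card T = 3 \<longrightarrow> F T = ranked s c r T)"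
    if "Q \<subseteq> U" for U
    using that
  proof (induction "card U" arbitrary: U rule: less_induct)
    case less
    show ?case
    proof (cases "U = Q")
      case True
      have "Suc n - card Q = s" using s by simp
      then show ?thesis using core_ranking_base[OF core s \<open>0 < s\<close> c] True by simp
    next
      case False
      then have "Q \<subset> U" using less.prems by auto
      then obtain m where m: "m \<in> U - Q" "\<forall>T\<subseteq>U. card T = 3 \<longrightarrow> m \<in> T \<longrightarrow> F T = {m}"
        using core_dominating[OF core] by blast
      have "card (U - {m}) < card U" using m by (intro card_Diff1_less) auto
      moreover have "Q \<subseteq> U - {m}" using less.prems m by auto
      ultimately obtain r where r: "bij_betw r (U - {m}) {Suc n - card (U - {m})..n}"
        "\<forall>T\<subseteq>U - {m}. card T = 3 \<longrightarrow> F T = ranked s c r T"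
        using less.hyps[of "U - {m}"] by metis
      have cU: "card U \<le> n" unfolding n by (intro card_mono) auto
      have cUQ: "card Q < card U" using \<open>Q \<subset> U\<close> by (simp add: psubset_card_mono)
      have cUm: "card (U - {m}) = card U - 1" using m by simp
      \<comment> \<open>Positions are counted from the end, so that the vertices of \<open>U\<close>
        occupy the last \<open>card U\<close> places.\<close>
      define k where "k = Suc n - card U"
      have k: "k < s" "Suc n - card (U - {m}) = Suc k" "k \<le> n" "k \<le> c"
        using cU cUQ cUm s c by (auto simp: k_def)
      define r' where "r' = r(m := k)"
      have "bij_betw r' (U - {m}) {Suc k..n}" using r(1) k by (simp add: r'_def bij_betw_def inj_on_def)
      then have "bij_betw r' ((U - {m}) \<union> {m}) ({Suc k..n} \<union> {k})"
        by (rule bij_betw_combine) (auto simp: r'_def)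
      moreover have "(U - {m}) \<union> {m} = U" "{Suc k..n} \<union> {k} = {k..n}" using m k by auto
      ultimately have bij: "bij_betw r' U {k..n}" by simp
      have gt: "k < r' x" if "x \<in> U" "x \<noteq> m" for x
      proof -
        have "r x \<in> {Suc k..n}" using r(1) k that by (auto simp: bij_betw_def)
        then show ?thesis using that by (simp add: r'_def)
      qed
      have rm: "r' m = k" by (simp add: r'_def)
      have "F T = ranked s c r' T" if T: "T \<subseteq> U" "card T = 3" for T
      proof (cases "m \<in> T")
        case True
        have ge: "k \<le> r' x" if "x \<in> T" for x using gt[of x] rm that T by (cases "x = m") auto
        have lt: "k < r' x" if "x \<in> T" "x \<noteq> m" for x using gt[of x] that T by auto
        have "ranked s c r' T = {m}"
        proof (intro equalityI subsetI)
          fix i assume i: "i \<in> ranked s c r' T"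
          have "\<not> s \<le> r' m" using rm k(1) by simp
          then have "i \<in> T" "r' i \<le> r' m" using i True by (auto simp: ranked_def)
          then show "i \<in> {m}" using lt[of i] rm by (cases "i = m") auto
        next
          fix i assume "i \<in> {m}"
          then show "i \<in> ranked s c r' T" using True rm ge k(4) by (simp add: ranked_def)
        qed
        then show ?thesis using m(2) T True by simp
      next
        case False
        then have "T \<subseteq> U - {m}" using T by auto
        then have "F T = ranked s c r T" using r(2) T by simp
        also have "\<dots> = ranked s c r' T" using False by (intro ranked_cong) (auto simp: r'_def)
        finally show ?thesis .
      qed
      then show ?thesis using bij unfolding k_def by blast
    qed
  qed
  have "Suc n - CARD('a) = 1" using n by simp
  then show ?thesis using *[of UNIV] by simp
qed

text \<open>The pairs come from cores of three, four and five vertices. For nine vertices they are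
  (7,7), (6,5) and (5,4), the index bounds in \<open>X6\<close>, \<open>Y6\<close> and
  \<open>Z6\<close>.\<close>

lemma extremal_ranking:
  assumes "excess UNIV = 2"
  shows "\<exists>r. bij_betw r UNIV {1..CARD('a)} \<and>
    (\<exists>(s,c)\<in>{(CARD('a) - 2, CARD('a) - 2), (CARD('a) - 3, CARD('a) - 4), (CARD('a) - 4, CARD('a) - 5)}.
      \<forall>T. card T = 3 \<longrightarrow> F T = ranked s c r T)"
proof -
  obtain Q e where core: "core Q e" using core_exists[OF assms] by auto
  have cQ: "card Q = 3 \<or> card Q = 4 \<or> card Q = 5" using core by (auto simp: core_def)
  have le: "card Q \<le> CARD('a)" by (intro card_mono) auto
  define s where "s = Suc CARD('a) - card Q"
  define c where "c = (if card Q = 3 then s else s - 1)"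
  have s: "s + card Q = Suc CARD('a)" "0 < s" using le by (auto simp: s_def)
  obtain r where r: "bij_betw r UNIV {1..CARD('a)}" "\<forall>T. card T = 3 \<longrightarrow> F T = ranked s c r T"
    using core_ranking[OF core refl s(1) c_def s(2)] by auto
  have "(s,c) \<in> {(CARD('a) - 2, CARD('a) - 2), (CARD('a) - 3, CARD('a) - 4), (CARD('a) - 4, CARD('a) - 5)}"
    using cQ by (auto simp: s_def c_def)
  then show ?thesis using r by blast
qed

end

section \<open>Centres combined with points of the second type\<close>

context centre_family
begin

lemma no_links_at_source:
  assumes "\<And>T. card T = 3 \<Longrightarrow> a \<in> T \<Longrightarrow> F T \<subseteq> {a}"
  shows "nbrs UNIV a = {}"
proof -
  have "\<not> linked a u" for u
  proof
    assume "linked a u"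
    then obtain k where k: "a \<noteq> u" "k \<noteq> a" "k \<noteq> u" "a \<in> F {a,u,k}" "u \<in> F {a,u,k}" using linkedE by metis
    then show False using assms[of "{a,u,k}"] by auto
  qed
  then show ?thesis by (simp add: nbrs_def)
qed

text \<open>The set \<open>A\<close> stands for the exceptional coordinates of the points of the
  second type, and 87 = 1 + 84 + 2. Two elements \<open>a\<close>, \<open>b\<close> of
  \<open>A\<close> make the seven triples \<open>{a,b,x}\<close> bad and leave \<open>a\<close>
  without links, which lowers the excess to at most 2 - 7.\<close>

lemma centres_and_sources:
  assumes card: "CARD('a) = 9"
    and sources: "\<And>a T. a \<in> A \<Longrightarrow> card T = 3 \<Longrightarrow> a \<in> T \<Longrightarrow> F T \<subseteq> {a}"
  shows "card A + (\<Sum>T | card T = 3. card (F T)) \<le> 87"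
    and "card A + (\<Sum>T | card T = 3. card (F T)) = 87 \<Longrightarrow>
      \<exists>r a. bij_betw r UNIV {1..9} \<and> A = {a} \<and> r a = 1 \<and>
        (\<exists>(s,c)\<in>{(7,7),(6,5),(5,4)}. \<forall>T. card T = 3 \<longrightarrow> F T = ranked s c r T)"
proof -
  let ?N = "\<Sum>T | card T = 3. card (F T)"
  have N: "int ?N = 84 + excess UNIV"
    unfolding sum_card_centres card by (simp add: numeral_eq_Suc)
  have small: "card A + ?N < 87" if two: "a \<in> A" "b \<in> A" "a \<noteq> b" for a b
  proof -
    have empty: "F {a,b,x} = {}" if "x \<noteq> a" "x \<noteq> b" for x
      using sources[of a "{a,b,x}"] sources[of b "{a,b,x}"] two that by auto
    have "(\<lambda>x. {a,b,x}) ` (UNIV - {a,b}) \<subseteq> bads_at UNIV a"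
      using empty two(3) by (auto simp: bads_at_def bads_def bad_def)
    moreover have "inj_on (\<lambda>x. {a,b,x}) (UNIV - {a,b})" by (auto simp: inj_on_def)
    ultimately have "card (UNIV - {a,b}) \<le> card (bads_at UNIV a)"
      by (metis card_image card_mono finite_bads_at)
    moreover have "card (UNIV - {a,b}) = 7" using card two(3) by (simp add: card_Diff_subset)
    ultimately have "excess UNIV \<le> - 5"
      using excess_remove[of a UNIV] excess_le_2[of "UNIV - {a}"] no_links_at_source[of a] sources two(1)
      by simp
    then have N79: "?N \<le> 79" using N by linarith
    show ?thesis
    \<comment> \<open>With at least eight elements in \<open>A\<close>, every triple contains two of
      them and has no centre.\<close>
    proof (cases "card A \<le> 7")
      case True
      then show ?thesis using N79 by linarith
    next
      case False
      have "F T = {}" if T: "card T = 3" for T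
      proof -
        have "card (T - A) \<le> card (UNIV - A)" by (intro card_mono) auto
        also have "\<dots> \<le> 1" using card False card_mono[of UNIV A] by (simp add: card_Diff_subset)
        finally have "card (T - A) \<le> 1" .
        moreover have "card T = card (T - A) + card (T \<inter> A)" using card_Diff_subset_Int[of T A] card_mono[of T "T \<inter> A"]
          by simp
        ultimately have "\<not> card (T \<inter> A) \<le> Suc 0" using T by linarith
        then obtain x y where "x \<in> T \<inter> A" "y \<in> T \<inter> A" "x \<noteq> y" by (auto simp: card_le_Suc0_iff_eq)
        then have "F T \<subseteq> {x}" "F T \<subseteq> {y}" using sources T by auto
        then show ?thesis using \<open>x \<noteq> y\<close> by auto
      qed
      then have "?N = 0" by simp
      moreover have "card A \<le> 9" using card card_mono[of UNIV A] by simp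
      ultimately show ?thesis by linarith
    qed
  qed
  have N86: "?N \<le> 86" using N excess_le_2[of UNIV] by linarith
  have cases: "card A \<le> 1 \<or> card A + ?N < 87"
  proof (cases "card A \<le> Suc 0")
    case False
    then obtain a b where "a \<in> A" "b \<in> A" "a \<noteq> b" by (auto simp: card_le_Suc0_iff_eq)
    then show ?thesis using small by blast
  qed simp
  show "card A + ?N \<le> 87" using cases N86 by linarith
  assume eq: "card A + ?N = 87"
  then have "card A = 1" "?N = 86" using cases N86 by linarith+
  then obtain a where a: "A = {a}" by (auto simp: card_1_singleton_iff)
  have "excess UNIV = 2" using N \<open>?N = 86\<close> by linarith
  from extremal_ranking[OF this] obtain r s c where r: "bij_betw r UNIV {1..9}"
    and sc: "(s,c) \<in> {(7,7),(6,5),(5,4)}" and F: "\<forall>T. card T = 3 \<longrightarrow> F T = ranked s c r T"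
    unfolding card by (auto simp del: insert_iff)
  \<comment> \<open>As \<open>1 \<le> c\<close>, the vertex of position 1 is a centre of every
    triple containing it; if it were not \<open>a\<close>, a triple through both would contradict
    \<open>sources\<close>.\<close>
  have "r a = 1"
  proof (rule ccontr)
    assume "r a \<noteq> 1"
    have inj: "inj r" and im: "range r = {1..9}" using r by (auto simp: bij_betw_def)
    have "1 \<in> range r" using im by simp
    then obtain m where m: "r m = 1" by (metis imageE)
    have "m \<noteq> a" using m \<open>r a \<noteq> 1\<close> by auto
    have "\<not> (UNIV :: 'a set) \<subseteq> {m,a}" using card_mono[of "{m,a}" UNIV] card
      by (auto simp: card_insert_if split: if_splits)
    then obtain x where x: "x \<noteq> m" "x \<noteq> a" by auto
    have T: "card {m,a,x} = 3" using x \<open>m \<noteq> a\<close> by simp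
    have "r y \<ge> 1" for y
    proof -
      have "r y \<in> {1..9}" using im by auto
      then show ?thesis by simp
    qed
    then have "m \<in> ranked s c r {m,a,x}" using m sc by (auto simp: ranked_def)
    then have "m \<in> F {m,a,x}" using F T by simp
    then show False using sources[of a "{m,a,x}"] a T \<open>m \<noteq> a\<close> by auto
  qed
  then show "\<exists>r a. bij_betw r UNIV {1..9} \<and> A = {a} \<and> r a = 1 \<and>
        (\<exists>(s,c)\<in>{(7,7),(6,5),(5,4)}. \<forall>T. card T = 3 \<longrightarrow> F T = ranked s c r T)"
    using r sc F a by blast
qed

end

subsection \<open>Points compatible with the Johnson graph\<close>

lemma sum_int_eq_0:
  fixes f :: "'b \<Rightarrow> int"
  assumes "finite A" "\<And>a. a \<in> A \<Longrightarrow> 0 \<le> f a" "sum f A = 0" "a \<in> A"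
  shows "f a = 0"
  using assms by (simp add: sum_nonneg_eq_0_iff)

lemma sum_int_pos:
  fixes f :: "'b \<Rightarrow> int"
  assumes "finite A" "\<And>a. a \<in> A \<Longrightarrow> 0 \<le> f a" "0 < sum f A"
  obtains a where "a \<in> A" "1 \<le> f a" "f a \<le> sum f A" "sum f (A - {a}) = sum f A - f a"
proof -
  have "\<exists>a\<in>A. f a \<noteq> 0" using assms(3) by (metis less_irrefl sum.neutral)
  then obtain a where a: "a \<in> A" "f a \<noteq> 0" by auto
  then have "1 \<le> f a" using assms(2)[of a] by auto
  moreover have "f a \<le> sum f A" using assms a by (intro member_le_sum) auto
  moreover have "sum f (A - {a}) = sum f A - f a" using a assms(1) by (simp add: sum_diff1)
  ultimately show ?thesis using that a by blast
qed

lemma sum_int_eq_1: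
  fixes f :: "'b \<Rightarrow> int"
  assumes "finite A" "\<And>a. a \<in> A \<Longrightarrow> 0 \<le> f a" "sum f A = 1"
  obtains a where "a \<in> A" "f a = 1" "\<And>b. b \<in> A \<Longrightarrow> b \<noteq> a \<Longrightarrow> f b = 0"
proof -
  obtain a where a: "a \<in> A" "1 \<le> f a" "f a \<le> sum f A" "sum f (A - {a}) = sum f A - f a"
    using sum_int_pos[of A f] assms by auto
  then have fa: "f a = 1" using assms(3) by simp
  moreover have "f b = 0" if "b \<in> A" "b \<noteq> a" for b
    using sum_int_eq_0[of "A - {a}" f b] a assms that fa by auto
  ultimately show ?thesis using that a by blast
qed

lemma sum_int_eq_2:
  fixes f :: "'b \<Rightarrow> int"
  assumes "finite A" "\<And>a. a \<in> A \<Longrightarrow> 0 \<le> f a" "sum f A = 2"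
  shows "(\<exists>a\<in>A. f a = 2 \<and> (\<forall>b\<in>A. b \<noteq> a \<longrightarrow> f b = 0)) \<or>
    (\<exists>a\<in>A. \<exists>b\<in>A. a \<noteq> b \<and> f a = 1 \<and> f b = 1 \<and> (\<forall>c\<in>A. c \<noteq> a \<longrightarrow> c \<noteq> b \<longrightarrow> f c = 0))"
proof -
  obtain a where a: "a \<in> A" "1 \<le> f a" "f a \<le> sum f A" "sum f (A - {a}) = sum f A - f a"
    using sum_int_pos[of A f] assms by auto
  consider "f a = 2" | "f a = 1" using a assms(3) by linarith
  then show ?thesis
  proof cases
    case 1
    then have "f b = 0" if "b \<in> A" "b \<noteq> a" for b
      using sum_int_eq_0[of "A - {a}" f b] a assms that by auto
    then show ?thesis using 1 a by blast
  next
    case 2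
    then have "sum f (A - {a}) = 1" using a assms by simp
    then obtain b where b: "b \<in> A - {a}" "f b = 1" "\<And>c. c \<in> A - {a} \<Longrightarrow> c \<noteq> b \<Longrightarrow> f c = 0"
      using sum_int_eq_1[of "A - {a}" f] assms by auto
    then show ?thesis using 2 a by blast
  qed
qed

lemma top_subset:
  fixes f :: "'b \<Rightarrow> real"
  assumes "finite V" "k \<le> card V"
  shows "\<exists>A\<subseteq>V. card A = k \<and> (\<forall>a\<in>A. \<forall>b\<in>V - A. f b \<le> f a)"
  using assms(2)
proof (induction k)
  case 0
  then show ?case by (intro exI[of _ "{}"]) simp
next
  case (Suc k)
  then obtain A where A: "A \<subseteq> V" "card A = k" "\<forall>a\<in>A. \<forall>b\<in>V - A. f b \<le> f a" by auto
  have "V - A \<noteq> {}"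
  proof
    assume "V - A = {}"
    then have "V = A" using A by auto
    then show False using A Suc.prems by simp
  qed
  then have "Max (f ` (V - A)) \<in> f ` (V - A)" using assms(1) by (intro Max_in) auto
  then obtain m where m: "m \<in> V - A" "f m = Max (f ` (V - A))" by auto
  have "f b \<le> f m" if "b \<in> V - A" for b using m(2) that assms(1) by simp
  moreover have "card (insert m A) = Suc k" using A m assms(1) finite_subset[of A V] by simp
  ultimately show ?case using A m by (intro exI[of _ "insert m A"]) auto
qed

text \<open>\<open>A\<close> and \<open>B\<close> have the largest and smallest sums over four
  coordinates; the difference of these sums is the total absolute deviation from the median
  \<open>f m\<close>.\<close>

lemma median_split:
  fixes f :: "'b::finite \<Rightarrow> real"
  assumes "CARD('b) = 9"
  obtains A B m where "card A = 4" "card B = 4" "A \<inter> B = {}" "m \<notin> A" "m \<notin> B" "A \<union> B \<union> {m} = UNIV"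
    "\<And>a. a \<in> A \<Longrightarrow> f m \<le> f a" "\<And>b. b \<in> B \<Longrightarrow> f b \<le> f m"
proof -
  obtain A where A: "card A = 4" "\<forall>a\<in>A. \<forall>b\<in>UNIV - A. f b \<le> f a"
    using top_subset[of UNIV 4 f] assms by auto
  have cA: "card (UNIV - A) = 5" using A assms by (simp add: card_Diff_subset)
  obtain B where B: "B \<subseteq> UNIV - A" "card B = 4" "\<forall>a\<in>B. \<forall>b\<in>(UNIV - A) - B. - f b \<le> - f a"
    using top_subset[of "UNIV - A" 4 "\<lambda>x. - f x"] cA by auto
  have "card (UNIV - A - B) = 1" using cA B by (simp add: card_Diff_subset)
  then obtain m where m: "UNIV - A - B = {m}" by (auto simp: card_1_singleton_iff)
  have mAB: "m \<in> UNIV - A - B" unfolding m by simp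
  show ?thesis
  proof (rule that[of A B m])
    show "A \<union> B \<union> {m} = UNIV" using m by auto
    show "f m \<le> f a" if "a \<in> A" for a using A that mAB by auto
    show "f b \<le> f m" if "b \<in> B" for b using B that mAB by auto
  qed (use A B mAB in auto)
qed

definition point_iii :: "9 \<Rightarrow> real^9" where "point_iii a = (\<chi> x. if x = a then 4/3 else 1/3)"
definition point_ii :: "9 \<Rightarrow> real^9" where "point_ii a = (\<chi> x. if x = a then -4/3 else 2/3)"
definition point_i :: "9 set \<Rightarrow> real^9" where "point_i E = (\<chi> x. if x \<in> E then -1/3 else 2/3)"
definition point_iv :: "9 \<Rightarrow> 9 set \<Rightarrow> real^9" where
  "point_iv i T = (\<chi> x. if x = i then -2/3 else if x \<in> T then 4/3 else 1/3)"

text \<open>Here \<^term>\<open>p\<close> and \<^term>\<open>r\<close> are the total deviations above and below the median coordinate and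
  \<^term>\<open>q\<close> is the sum of the squared deviations; modulo 9 the equation forces \<open>p - r \<in> {1, -2}\<close>.\<close>

lemma deviation_cases:
  fixes p r q k l :: int
  assumes "20 + 8 * (p - r) - (p - r)^2 + 9 * q = 18 * (p + k)"
    "0 \<le> p" "0 \<le> r" "1 \<le> k" "l \<le> 4" "p + r = l - k"
  shows "(p = 1 \<and> r = 0) \<or> (p = 0 \<and> r = 2) \<or> (p = 2 \<and> r = 1 \<and> q = 3)"
proof -
  have "p = 0 \<or> p = 1 \<or> p = 2 \<or> p = 3" "r = 0 \<or> r = 1 \<or> r = 2 \<or> r = 3" using assms by linarith+
  then show ?thesis using assms by (elim disjE) (simp_all, presburger+)
qed

text \<open>By \<open>dist_J_vector\<close>, hypothesis \<open>H\<close> says that the squared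
  distances from \<open>x\<close> to the vectors of the Johnson graph are among 2, 4, 6, 8.\<close>

lemma point_classification:
  fixes x :: "real^9"
  assumes sum4: "(\<Sum>i\<in>UNIV. x $ i) = 4"
    and H: "\<And>S. card S = 4 \<Longrightarrow> \<exists>k\<in>{1..4::int}. 2 * (\<Sum>i\<in>S. x $ i) = (\<Sum>i\<in>UNIV. (x $ i)^2) + 4 - 2 * real_of_int k"
  shows "(\<exists>a. x = point_iii a) \<or> (\<exists>a. x = point_ii a) \<or> (\<exists>E. card E = 2 \<and> x = point_i E) \<or>
    (\<exists>i T. i \<in> T \<and> card T = 3 \<and> x = point_iv i T)"
proof -
  define N where "N = (\<Sum>i\<in>UNIV. (x $ i)^2)"
  obtain A B m where AB: "card A = 4" "card B = 4" "A \<inter> B = {}" "m \<notin> A" "m \<notin> B" "A \<union> B \<union> {m} = UNIV"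
    and ge: "\<And>a. a \<in> A \<Longrightarrow> x $ m \<le> x $ a" and le: "\<And>b. b \<in> B \<Longrightarrow> x $ b \<le> x $ m"
    using median_split[of "\<lambda>i. x $ i"] by auto
  \<comment> \<open>Exchanging \<open>m\<close> for \<open>i\<close> in a four-element set changes
    the right-hand side of \<open>H\<close> by an even integer and the left-hand side by twice the
    difference of the two coordinates.\<close>
  have "\<exists>z::int. x $ i = x $ m + of_int z" for i
  proof (cases "i = m")
    case True
    then show ?thesis by (intro exI[of _ 0]) simp
  next
    case False
    have "3 \<le> card (UNIV - {i,m})" using False by (simp add: card_Diff_subset)
    then obtain S where S: "S \<subseteq> UNIV - {i,m}" "card S = 3" by (meson obtain_subset_with_card_n)
    have nin: "i \<notin> S" "m \<notin> S" using S by auto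
    then have c: "card (insert i S) = 4" "card (insert m S) = 4" using S(2) by simp_all
    obtain k where k: "2 * (\<Sum>j\<in>insert i S. x $ j) = N + 4 - 2 * real_of_int k" using H[OF c(1)] by (auto simp: N_def)
    obtain l where l: "2 * (\<Sum>j\<in>insert m S. x $ j) = N + 4 - 2 * real_of_int l" using H[OF c(2)] by (auto simp: N_def)
    have "x $ i = x $ m + of_int (l - k)" using k l nin by (simp add: algebra_simps)
    then show ?thesis by blast
  qed
  then obtain d :: "9 \<Rightarrow> int" where d: "\<And>i. x $ i = x $ m + of_int (d i)" by metis
  have dA: "0 \<le> d a" if "a \<in> A" for a using ge[OF that] d[of a] by simp
  have dB: "0 \<le> - d b" if "b \<in> B" for b using le[OF that] d[of b] by simp
  have dm: "d m = 0" using d[of m] by simp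
  define p where "p = (\<Sum>a\<in>A. d a)"
  define r where "r = (\<Sum>b\<in>B. - d b)"
  define q where "q = (\<Sum>i\<in>UNIV. (d i)^2)"
  have dsum: "(\<Sum>i\<in>UNIV. d i) = p - r"
  proof -
    have "(\<Sum>i\<in>UNIV. d i) = (\<Sum>i\<in>A \<union> B \<union> {m}. d i)" using AB(6) by simp
    also have "\<dots> = p - r" using AB(3,4,5) dm by (simp add: sum.union_disjoint p_def r_def sum_negf)
    finally show ?thesis .
  qed
  have m9: "9 * x $ m + of_int (p - r) = 4"
  proof -
    have "(\<Sum>i\<in>UNIV. x $ i) = (\<Sum>i\<in>UNIV. x $ m + of_int (d i))" by (rule sum.cong[OF refl]) (rule d)
    also have "\<dots> = 9 * x $ m + of_int (\<Sum>i\<in>UNIV. d i)" by (simp add: sum.distrib)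
    finally show ?thesis using sum4 dsum by simp
  qed
  have N: "N = 9 * (x $ m)^2 + 2 * x $ m * of_int (p - r) + of_int q"
  proof -
    have "N = (\<Sum>i\<in>UNIV. (x $ m + of_int (d i))^2)" unfolding N_def by (rule sum.cong[OF refl]) (metis d)
    also have "\<dots> = (\<Sum>i\<in>UNIV. (x $ m)^2 + 2 * x $ m * of_int (d i) + of_int ((d i)^2))"
      by (simp add: power2_sum algebra_simps)
    also have "\<dots> = 9 * (x $ m)^2 + 2 * x $ m * of_int (\<Sum>i\<in>UNIV. d i) + of_int q"
      by (simp add: sum.distrib q_def sum_distrib_left)
    finally show ?thesis using dsum by simp
  qed
  obtain k where k: "1 \<le> k" "2 * (\<Sum>j\<in>A. x $ j) = N + 4 - 2 * real_of_int k" using H[OF AB(1)] by (auto simp: N_def)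
  obtain l where l: "l \<le> 4" "2 * (\<Sum>j\<in>B. x $ j) = N + 4 - 2 * real_of_int l" using H[OF AB(2)] by (auto simp: N_def)
  have sA: "(\<Sum>j\<in>A. x $ j) = 4 * x $ m + of_int p"
  proof -
    have "(\<Sum>j\<in>A. x $ j) = (\<Sum>j\<in>A. x $ m + of_int (d j))" by (rule sum.cong[OF refl]) (rule d)
    then show ?thesis using AB(1) by (simp add: sum.distrib p_def)
  qed
  have sB: "(\<Sum>j\<in>B. x $ j) = 4 * x $ m - of_int r"
  proof -
    have "(\<Sum>j\<in>B. x $ j) = (\<Sum>j\<in>B. x $ m + of_int (d j))" by (rule sum.cong[OF refl]) (rule d)
    then show ?thesis using AB(2) by (simp add: sum.distrib r_def sum_negf)
  qed
  have "real_of_int (p + r) = real_of_int (l - k)" using sA sB k(2) l(2) by simp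
  \<comment> \<open>Since \<open>1 \<le> k\<close> and \<open>l \<le> 4\<close>, the total deviation
    \<open>p + r\<close> is at most 3.\<close>
  then have pr: "p + r = l - k" by linarith
  have xm: "x $ m = (4 - of_int (p - r)) / 9" using m9 by simp
  \<comment> \<open>This is the condition for \<open>A\<close>, with the median coordinate
    eliminated by \<open>xm\<close> and denominators cleared.\<close>
  have "real_of_int (20 + 8 * (p - r) - (p - r)^2 + 9 * q) = real_of_int (18 * (p + k))"
    using sA k(2) unfolding N xm by (simp add: field_simps power2_eq_square)
  then have eq: "20 + 8 * (p - r) - (p - r)^2 + 9 * q = 18 * (p + k)" by linarith
  have p0: "0 \<le> p" unfolding p_def by (intro sum_nonneg dA)
  have r0: "0 \<le> r" unfolding r_def by (intro sum_nonneg dB)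
  have cases: "(p = 1 \<and> r = 0) \<or> (p = 0 \<and> r = 2) \<or> (p = 2 \<and> r = 1 \<and> q = 3)"
    using deviation_cases[OF eq p0 r0 k(1) l(1) pr] .
  have univ: "i \<in> A \<or> i \<in> B \<or> i = m" for i using AB(6) by auto
  from cases show ?thesis
  proof (elim disjE conjE)
    assume pr: "p = 1" "r = 0"
    obtain a where a: "a \<in> A" "d a = 1" "\<And>b. b \<in> A \<Longrightarrow> b \<noteq> a \<Longrightarrow> d b = 0"
      using sum_int_eq_1[of A d] dA pr by (auto simp: p_def)
    have "d b = 0" if "b \<in> B" for b
      using sum_int_eq_0[of B "\<lambda>b. - d b" b] dB pr that by (auto simp: r_def)
    then have di: "d i = (if i = a then 1 else 0)" for i using univ[of i] a dm by auto
    have xm': "x $ m = 1/3" using xm pr by simp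
    have "x $ i = point_iii a $ i" for i using d[of i] di[of i] xm' by (simp add: point_iii_def)
    then have "x = point_iii a" by (simp add: vec_eq_iff)
    then show ?thesis by (intro disjI1 exI)
  next
    assume pr: "p = 0" "r = 2"
    have dA0: "d a = 0" if "a \<in> A" for a
      using sum_int_eq_0[of A d a] dA pr that by (auto simp: p_def)
    have xm': "x $ m = 2/3" using xm pr by simp
    have "(\<exists>a\<in>B. - d a = 2 \<and> (\<forall>b\<in>B. b \<noteq> a \<longrightarrow> - d b = 0)) \<or>
      (\<exists>a\<in>B. \<exists>b\<in>B. a \<noteq> b \<and> - d a = 1 \<and> - d b = 1 \<and> (\<forall>c\<in>B. c \<noteq> a \<longrightarrow> c \<noteq> b \<longrightarrow> - d c = 0))"
      using sum_int_eq_2[of B "\<lambda>b. - d b"] dB pr by (auto simp: r_def)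
    then show ?thesis
    proof (elim disjE bexE conjE)
      fix a assume a: "a \<in> B" "- d a = 2" "\<forall>b\<in>B. b \<noteq> a \<longrightarrow> - d b = 0"
      then have di: "d i = (if i = a then - 2 else 0)" for i using univ[of i] dA0 dm by auto
      have "x $ i = point_ii a $ i" for i using d[of i] di[of i] xm' by (simp add: point_ii_def)
      then have "x = point_ii a" by (simp add: vec_eq_iff)
      then have "\<exists>a. x = point_ii a" by (rule exI)
      then show ?thesis by simp
    next
      fix a b assume ab: "a \<in> B" "b \<in> B" "a \<noteq> b" "- d a = 1" "- d b = 1"
        "\<forall>c\<in>B. c \<noteq> a \<longrightarrow> c \<noteq> b \<longrightarrow> - d c = 0"
      then have di: "d i = (if i \<in> {a,b} then - 1 else 0)" for i using univ[of i] dA0 dm by auto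
      have "x $ i = point_i {a,b} $ i" for i using d[of i] di[of i] xm' by (simp add: point_i_def)
      then have "x = point_i {a,b}" by (simp add: vec_eq_iff)
      moreover have "card {a,b} = 2" using ab by simp
      ultimately have "\<exists>E. card E = 2 \<and> x = point_i E" by (intro exI conjI)
      then show ?thesis by simp
    qed
  next
    assume pr: "p = 2" "r = 1" "q = 3"
    have xm': "x $ m = 1/3" using xm pr by simp
    obtain c where c: "c \<in> B" "- d c = 1" "\<And>b. b \<in> B \<Longrightarrow> b \<noteq> c \<Longrightarrow> - d b = 0"
      using sum_int_eq_1[of B "\<lambda>b. - d b"] dB pr by (auto simp: r_def)
    have "(\<exists>a\<in>A. d a = 2 \<and> (\<forall>b\<in>A. b \<noteq> a \<longrightarrow> d b = 0)) \<or>
      (\<exists>a\<in>A. \<exists>b\<in>A. a \<noteq> b \<and> d a = 1 \<and> d b = 1 \<and> (\<forall>c\<in>A. c \<noteq> a \<longrightarrow> c \<noteq> b \<longrightarrow> d c = 0))"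
      using sum_int_eq_2[of A d] dA pr by (auto simp: p_def)
    then show ?thesis
    proof (elim disjE bexE conjE)
      \<comment> \<open>A coordinate with deviation 2 alone contributes 4 to \<open>q\<close>,
        against \<open>q = 3\<close>.\<close>
      fix a assume "a \<in> A" "d a = 2"
      have "(d a)^2 \<le> q" unfolding q_def by (intro member_le_sum) auto
      then show ?thesis using \<open>d a = 2\<close> pr by simp
    next
      fix a b assume ab: "a \<in> A" "b \<in> A" "a \<noteq> b" "d a = 1" "d b = 1"
        "\<forall>c\<in>A. c \<noteq> a \<longrightarrow> c \<noteq> b \<longrightarrow> d c = 0"
      have ne: "c \<noteq> a" "c \<noteq> b" using ab c AB(3) by auto
      have "d c = - 1" using c by simp
      have di: "d i = (if i = c then - 1 else if i \<in> {c,a,b} then 1 else 0)" for i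
      proof -
        consider "i \<in> A" | "i \<in> B" | "i = m" using univ by blast
        then show ?thesis
        proof cases
          case 1
          then have "i \<noteq> c" using c AB(3) by auto
          then show ?thesis using 1 ab by auto
        next
          case 2
          then have "i \<noteq> a" "i \<noteq> b" using ab AB(3) by auto
          then show ?thesis using 2 c(3)[of i] \<open>d c = - 1\<close> by auto
        next
          case 3
          then have "i \<noteq> c" "i \<noteq> a" "i \<noteq> b" using AB c ab by auto
          then show ?thesis using 3 dm by simp
        qed
      qed
      have "x $ i = point_iv c {c,a,b} $ i" for i using d[of i] di[of i] xm' by (simp add: point_iv_def)
      then have "x = point_iv c {c,a,b}" by (simp add: vec_eq_iff)
      moreover have "card {c,a,b} = 3" "c \<in> {c,a,b}" using ab ne by simp_all
      ultimately have "\<exists>i T. i \<in> T \<and> card T = 3 \<and> x = point_iv i T" by (intro exI conjI)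
      then show ?thesis by simp
    qed
  qed
qed

subsection \<open>Distances and coordinate permutations\<close>

definition J_vector :: "9 set \<Rightarrow> real^9" where "J_vector S = (\<chi> x. if x \<in> S then 1 else 0)"

lemma J94_eq: "J94 = J_vector ` {S. card S = 4}"
proof (intro equalityI subsetI)
  fix x assume x: "x \<in> J94"
  then have "x $ i = J_vector {i. x $ i = 1} $ i" for i by (auto simp: J94_def J_vector_def)
  then have "x = J_vector {i. x $ i = 1}" unfolding vec_eq_iff by (rule allI)
  moreover have "card {i. x $ i = 1} = 4" using x by (simp add: J94_def)
  ultimately show "x \<in> J_vector ` {S. card S = 4}" by blast
qed (auto simp: J94_def J_vector_def)

lemma dist_sq: "(dist x y)\<^sup>2 = (\<Sum>i\<in>UNIV. (x $ i - y $ i)\<^sup>2)" for x y :: "real^'n::finite"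
  by (simp add: dist_norm norm_vec_def L2_set_def sum_nonneg)

lemma sum_indicator: "(\<Sum>i\<in>UNIV. if i \<in> A then 1 else 0 :: real) = real (card A)" for A :: "'a::finite set"
  by (simp add: sum.If_cases)

lemma dist_J_vector_J_vector: "(dist (J_vector S) (J_vector T))\<^sup>2 = real (card ((S - T) \<union> (T - S)))"
proof -
  have "(J_vector S $ i - J_vector T $ i)\<^sup>2 = (if i \<in> (S - T) \<union> (T - S) then 1 else 0)" for i
    by (auto simp: J_vector_def)
  then have "(dist (J_vector S) (J_vector T))\<^sup>2 = (\<Sum>i\<in>UNIV. if i \<in> (S - T) \<union> (T - S) then 1 else 0)"
    by (simp only: dist_sq)
  also have "\<dots> = real (card ((S - T) \<union> (T - S)))"
    by (rule sum_indicator)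
  finally show ?thesis .
qed

lemma dist_J_vector:
  assumes "card S = 4"
  shows "(dist x (J_vector S))\<^sup>2 = (\<Sum>i\<in>UNIV. (x $ i)\<^sup>2) + 4 - 2 * (\<Sum>i\<in>S. x $ i)"
proof -
  have "(x $ i - J_vector S $ i)\<^sup>2 = (x $ i)\<^sup>2 + (if i \<in> S then 1 - 2 * x $ i else 0)" for i
    by (simp add: J_vector_def power2_diff)
  then have "(dist x (J_vector S))\<^sup>2 = (\<Sum>i\<in>UNIV. (x $ i)\<^sup>2) + (\<Sum>i\<in>UNIV. if i \<in> S then 1 - 2 * x $ i else 0)"
    unfolding dist_sq by (simp add: sum.distrib)
  also have "(\<Sum>i\<in>UNIV. if i \<in> S then 1 - 2 * x $ i else 0) = (\<Sum>i\<in>S. 1 - 2 * x $ i)"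
    by (simp add: sum.If_cases)
  also have "\<dots> = 4 - 2 * (\<Sum>i\<in>S. x $ i)" using assms by (simp add: sum_subtractf sum_distrib_left)
  finally show ?thesis by simp
qed

text \<open>The Johnson graph already realises four distances, so the four-distance set
  \<open>X\<close> has no others.\<close>

lemma distances:
  assumes X: "distance_set 4 X" "J94 \<subseteq> X" and xy: "x \<in> X" "y \<in> X" "x \<noteq> y"
  shows "\<exists>k\<in>{1..4::int}. (dist x y)\<^sup>2 = 2 * real_of_int k"
proof -
  let ?D = "{dist x y | x y. x \<in> X \<and> y \<in> X \<and> x \<noteq> y}"
  have D: "card ?D = 4" using X by (simp add: distance_set_def)
  have mem: "sqrt (real n) \<in> ?D"
    if "card S = 4" "card T = 4" "card ((S - T) \<union> (T - S)) = n" "0 < n" for S T :: "9 set" and n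
  proof -
    have "dist (J_vector S) (J_vector T) = sqrt (real n)"
      unfolding that(3)[symmetric] by (simp flip: dist_J_vector_J_vector)
    moreover have "J_vector S \<noteq> J_vector T"
    proof
      assume "J_vector S = J_vector T"
      then have "real (card ((S - T) \<union> (T - S))) = 0" unfolding dist_J_vector_J_vector[symmetric] by simp
      then show False using that by auto
    qed
    moreover have "J_vector S \<in> X" "J_vector T \<in> X" using X(2) that by (auto simp: J94_eq)
    ultimately show ?thesis by force
  qed
  \<comment> \<open>Four-element sets sharing 3, 2, 1 and 0 indices have symmetric differences of
    size 2, 4, 6 and 8.\<close>
  have "sqrt 2 \<in> ?D" using mem[of "{1,2,3,4}" "{1,2,3,5}" 2] by (simp add: insert_Diff_if)
  moreover have "sqrt 4 \<in> ?D" using mem[of "{1,2,3,4}" "{1,2,5,6}" 4] by (simp add: insert_Diff_if)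
  moreover have "sqrt 6 \<in> ?D" using mem[of "{1,2,3,4}" "{1,5,6,7}" 6] by (simp add: insert_Diff_if)
  moreover have "sqrt 8 \<in> ?D" using mem[of "{1,2,3,4}" "{5,6,7,8}" 8] by (simp add: insert_Diff_if)
  ultimately have sub: "{sqrt 2, sqrt 4, sqrt 6, sqrt 8} \<subseteq> ?D" by blast
  have c4: "card {sqrt 2, sqrt 4, sqrt 6, sqrt 8} = 4"
    by (simp only: card_insert_if finite_insert finite.emptyI insert_iff empty_iff real_sqrt_eq_iff) simp
  have "finite ?D" using D by (intro card_ge_0_finite) simp
  then have "{sqrt 2, sqrt 4, sqrt 6, sqrt 8} = ?D"
    by (rule card_subset_eq[OF _ sub]) (simp only: c4 D)
  moreover have "dist x y \<in> ?D" using xy by blast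
  ultimately have "dist x y \<in> {sqrt 2, sqrt 4, sqrt 6, sqrt 8}" by (simp only:)
  then have "(dist x y)\<^sup>2 \<in> {2, 4, 6, 8}" by auto
  then show ?thesis
  proof (elim insertE emptyE)
    assume "(dist x y)\<^sup>2 = 2" then show ?thesis by (intro bexI[of _ 1]) auto
  next
    assume "(dist x y)\<^sup>2 = 4" then show ?thesis by (intro bexI[of _ 2]) auto
  next
    assume "(dist x y)\<^sup>2 = 6" then show ?thesis by (intro bexI[of _ 3]) auto
  next
    assume "(dist x y)\<^sup>2 = 8" then show ?thesis by (intro bexI[of _ 4]) auto
  qed
qed

text \<open>This excluded distance is the origin of \<open>centre_unique\<close>: the entries differ
  by 2 at \<open>i\<close> and \<open>j\<close> and by 1 at \<open>k\<close> and
  \<open>l\<close>.\<close>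

lemma dist_point_iv_point_iv:
  assumes "i \<noteq> j" "k \<notin> {i,j}" "l \<notin> {i,j}" "k \<noteq> l"
  shows "(dist (point_iv i {i,j,k}) (point_iv j {i,j,l}))\<^sup>2 = 10"
proof -
  have "(point_iv i {i,j,k} $ x - point_iv j {i,j,l} $ x)\<^sup>2 =
      (if x = i then 4 else 0) + (if x = j then 4 else 0) + (if x = k then 1 else 0) + (if x = l then 1 else 0)" for x
    using assms by (auto simp: point_iv_def power2_eq_square)
  then show ?thesis unfolding dist_sq by (simp add: sum.distrib)
qed

lemma dist_point_ii_point_iv:
  assumes "i \<noteq> a" "b \<notin> {i,a}"
  shows "(dist (point_ii a) (point_iv i {i,a,b}))\<^sup>2 = 10"
proof -
  \<comment> \<open>Every coordinate contributes at least \<open>1/9\<close>, which is the exact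
    value off the triple; the other summands are the surplus at \<open>a\<close>, \<open>i\<close>
    and \<open>b\<close>.\<close>
  have "(point_ii a $ x - point_iv i {i,a,b} $ x)\<^sup>2 =
      1/9 + (if x = a then 7 else 0) + (if x = i then 5/3 else 0) + (if x = b then 1/3 else 0)" for x
    using assms by (auto simp: point_iv_def point_ii_def power2_eq_square)
  then show ?thesis unfolding dist_sq by (simp add: sum.distrib)
qed

section \<open>Indices of type \<open>9\<close> and the action of permutations\<close>

lemma of_nat_9: "of_nat ` {1..9} = (UNIV :: 9 set)" and inj_of_nat_9: "inj_on (of_nat :: nat \<Rightarrow> 9) {1..9}"
proof -
  show inj: "inj_on (of_nat :: nat \<Rightarrow> 9) {1..9}"
  proof -
    have "{1..9::nat} = {1,2,3,4,5,6,7,8,9}" by auto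
    then show ?thesis by simp
  qed
  have "card (of_nat ` {1..9} :: 9 set) = CARD(9)" using inj by (simp add: card_image)
  then show "of_nat ` {1..9} = (UNIV :: 9 set)" by (intro card_subset_eq) auto
qed

lemma forall_9: "(\<forall>i::9. P i) \<longleftrightarrow> P 1 \<and> P 2 \<and> P 3 \<and> P 4 \<and> P 5 \<and> P 6 \<and> P 7 \<and> P 8 \<and> P 9"
proof -
  have "(\<forall>i::9. P i) \<longleftrightarrow> (\<forall>i\<in>of_nat ` {1..9}. P i)" by (simp only: of_nat_9 ball_UNIV)
  also have "{1..9::nat} = {1,2,3,4,5,6,7,8,9}" by auto
  finally show ?thesis by simp
qed

lemma replicate_eqs: "replicate 2 x = [x,x]" "replicate 7 x = [x,x,x,x,x,x,x]" "replicate 8 x = [x,x,x,x,x,x,x,x]"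
  by (simp_all add: numeral_eq_Suc)

lemma vector_point_i: "vector (replicate 7 (2/3) @ replicate 2 (-1/3)) = point_i {8,9}"
  unfolding replicate_eqs by (simp add: vec_eq_iff forall_9 vector_def point_i_def)

lemma vector_point_iii: "vector (4/3 # replicate 8 (1/3)) = point_iii 1"
  unfolding replicate_eqs by (simp add: vec_eq_iff forall_9 vector_def point_iii_def)

lemma vector_point_ii: "vector (-4/3 # replicate 8 (2/3)) = point_ii 1"
  unfolding replicate_eqs by (simp add: vec_eq_iff forall_9 vector_def point_ii_def)

text \<open>Coordinates are read through \<open>p\<close>, so index sets transform by preimage and
  distinguished indices by \<open>inv p\<close>.\<close>

lemma permute_J_vector: "permute_coords p (J_vector S) = J_vector (p -` S)"
  by (simp add: permute_coords_def J_vector_def vec_eq_iff)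

lemma permute_point_i: "permute_coords p (point_i S) = point_i (p -` S)"
  by (simp add: permute_coords_def point_i_def vec_eq_iff)

lemma eq_inv_permutes_iff: "p permutes UNIV \<Longrightarrow> x = inv p y \<longleftrightarrow> p x = y"
  by (metis permutes_inv_eq)

lemma permute_point_ii: "p permutes UNIV \<Longrightarrow> permute_coords p (point_ii a) = point_ii (inv p a)"
  by (auto simp: permute_coords_def point_ii_def vec_eq_iff eq_inv_permutes_iff)

lemma permute_point_iii: "p permutes UNIV \<Longrightarrow> permute_coords p (point_iii a) = point_iii (inv p a)"
  by (auto simp: permute_coords_def point_iii_def vec_eq_iff eq_inv_permutes_iff)

lemma permute_point_iv: "p permutes UNIV \<Longrightarrow> permute_coords p (point_iv i T) = point_iv (inv p i) (p -` T)"
  by (auto simp: permute_coords_def point_iv_def vec_eq_iff eq_inv_permutes_iff)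

lemma card_vimage_permutes: "p permutes UNIV \<Longrightarrow> card (p -` S) = card S"
  by (metis bij_vimage_eq_inv_image card_image permutes_bij permutes_inv inj_on_subset permutes_inj subset_UNIV)

lemma permutes_mapping_set:
  fixes S T :: "'a::finite set"
  assumes "card S = card T"
  shows "\<exists>p. p permutes UNIV \<and> p -` T = S"
proof -
  obtain f where f: "bij_betw f S T" using finite_same_card_bij[OF _ _ assms] by auto
  have "card (- S) = card (- T)" using assms by (simp add: Compl_eq_Diff_UNIV card_Diff_subset)
  then obtain g where g: "bij_betw g (- S) (- T)" using finite_same_card_bij[of "- S" "- T"] by auto
  define p where "p x = (if x \<in> S then f x else g x)" for x
  have "bij_betw p S T" using f by (subst bij_betw_cong[of _ p f]) (auto simp: p_def)
  moreover have "bij_betw p (- S) (- T)" using g by (subst bij_betw_cong[of _ p g]) (auto simp: p_def)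
  ultimately have "bij_betw p (S \<union> - S) (T \<union> - T)" by (rule bij_betw_combine) auto
  then have "p permutes UNIV" by (intro bij_imp_permutes) simp_all
  moreover have "p x \<in> T \<longleftrightarrow> x \<in> S" for x
    using bij_betwE[OF f] bij_betwE[OF g] by (cases "x \<in> S") (auto simp: p_def)
  then have "p -` T = S" by (auto simp: vimage_def)
  ultimately show ?thesis by blast
qed

lemma image_vimage_permutes:
  fixes p :: "'a::finite \<Rightarrow> 'a"
  assumes "p permutes UNIV"
  shows "(\<lambda>S. p -` S) ` {S. card S = k} = {S. card S = k}"
proof (intro equalityI subsetI)
  fix S :: "'a set" assume "S \<in> {S. card S = k}"
  moreover have "S = p -` (inv p -` S)"
    using permutes_inverses[OF assms] by auto
  ultimately show "S \<in> (\<lambda>S. p -` S) ` {S. card S = k}"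
    using card_vimage_permutes[OF permutes_inv[OF assms], of S] by blast
qed (use card_vimage_permutes[OF assms] in auto)

lemma X_i_eq: "X_i = point_i ` {E. card E = 2}"
proof (intro equalityI subsetI)
  fix x assume "x \<in> X_i"
  then obtain p where p: "p permutes UNIV" "x = point_i (p -` {8,9})"
    unfolding X_i_def vector_point_i coord_permutations_def by (auto simp: permute_point_i)
  then show "x \<in> point_i ` {E. card E = 2}" using card_vimage_permutes[OF p(1)] by simp
next
  fix x assume "x \<in> point_i ` {E. card E = 2}"
  then obtain E where E: "card E = 2" "x = point_i E" by auto
  then have "card E = card {8,9::9}" by simp
  then obtain p where "p permutes UNIV" "p -` {8,9} = E" using permutes_mapping_set by blast
  then show "x \<in> X_i"
    using E unfolding X_i_def vector_point_i coord_permutations_def by (auto simp: permute_point_i)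
qed

lemma X_iii_eq: "X_iii = range point_iii"
proof (intro equalityI subsetI)
  fix x assume "x \<in> X_iii"
  then show "x \<in> range point_iii"
    unfolding X_iii_def vector_point_iii coord_permutations_def by (auto simp: permute_point_iii)
next
  fix x assume "x \<in> range point_iii"
  then obtain a where a: "x = point_iii a" by auto
  have "Transposition.transpose a 1 permutes UNIV" by (simp add: permutes_swap_id)
  moreover from this have "x = permute_coords (Transposition.transpose a 1) (point_iii 1)"
    by (simp add: permute_point_iii a)
  ultimately show "x \<in> X_iii" unfolding X_iii_def vector_point_iii coord_permutations_def by blast
qed

section \<open>The vectors of \<open>L162\<close> as centred triples\<close>

definition L_vector :: "9 \<Rightarrow> 9 set \<Rightarrow> real^9" where
  "L_vector i T = (\<chi> x. if x = i then -1 else if x \<in> T then 1 else 0)"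

lemma phi_L_vector: "phi (L_vector i T) = point_iv i T"
  by (simp add: phi_def L_vector_def point_iv_def vec_eq_iff)

lemma L162_eq: "L162 = {L_vector i T | i T. card T = 3 \<and> i \<in> T}"
proof (intro equalityI subsetI)
  fix x assume "x \<in> L162"
  then have c: "card {i. x $ i = -1} = 1" "card {i. x $ i = 0} = 6" "card {i. x $ i = 1} = 2"
    by (auto simp: L162_def)
  then obtain i where i: "{i. x $ i = -1} = {i}" by (auto simp: card_1_singleton_iff)
  let ?T = "insert i {i. x $ i = 1}"
  have "i \<in> {i. x $ i = -1}" using i by simp
  then have "i \<notin> {i. x $ i = 1}" by simp
  then have T: "card ?T = 3" using c by simp
  \<comment> \<open>The prescribed counts 1 + 6 + 2 exhaust the nine coordinates, so no other entry
    occurs.\<close>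
  have "card ({i. x $ i = -1} \<union> {i. x $ i = 0} \<union> {i. x $ i = 1}) = CARD(9)"
    using c by (subst card_Un_disjoint; (subst card_Un_disjoint)?) auto
  then have "{i. x $ i = -1} \<union> {i. x $ i = 0} \<union> {i. x $ i = 1} = UNIV"
    by (intro card_subset_eq) auto
  then have cases: "j \<in> {i. x $ i = -1} \<or> x $ j = 0 \<or> x $ j = 1" for j by blast
  have "x $ j = L_vector i ?T $ j" for j
    using cases[of j] i by (auto simp: L_vector_def)
  then have "x = L_vector i ?T" unfolding vec_eq_iff by (rule allI)
  then show "x \<in> {L_vector i T | i T. card T = 3 \<and> i \<in> T}" using T by blast
next
  fix x assume "x \<in> {L_vector i T | i T. card T = 3 \<and> i \<in> T}"
  then obtain i T where x: "x = L_vector i T" "card T = 3" "i \<in> T" by auto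
  have "{j. x $ j = -1} = {i}" "{j. x $ j = 1} = T - {i}" "{j. x $ j = 0} = - T"
    using x by (auto simp: L_vector_def)
  then show "x \<in> L162" using x by (simp add: L162_def Compl_eq_Diff_UNIV card_Diff_subset)
qed

text \<open>Order comparisons of indices are made on these positions; in particular the index
  \<open>9 = 0\<close> has position 9.\<close>

definition pos :: "9 \<Rightarrow> nat" where "pos = the_inv_into {1..9} of_nat"

lemma pos_of_nat: "j \<in> {1..9} \<Longrightarrow> pos (of_nat j) = j"
  unfolding pos_def by (rule the_inv_into_f_f[OF inj_of_nat_9])

lemma of_nat_pos: "of_nat (pos x) = x" and pos_range: "pos x \<in> {1..9}"
proof -
  have "x \<in> of_nat ` {1..9}" unfolding of_nat_9 by (rule UNIV_I)
  then obtain j where "j \<in> {1..9}" "x = of_nat j" by blast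
  then show "of_nat (pos x) = x" "pos x \<in> {1..9}" using pos_of_nat by simp_all
qed

lemma avoid_iff:
  assumes "j \<le> 9"
  shows "(\<forall>j'\<in>{1..<j}. of_nat j' \<notin> T) \<longleftrightarrow> (\<forall>x\<in>T. j \<le> pos x)"
proof (intro iffI ballI)
  fix x assume *: "\<forall>j'\<in>{1..<j}. of_nat j' \<notin> T" and x: "x \<in> T"
  show "j \<le> pos x"
  proof (rule ccontr)
    assume "\<not> j \<le> pos x"
    then have "pos x \<in> {1..<j}" using pos_range[of x] by simp
    then show False using * x of_nat_pos[of x] by metis
  qed
next
  fix j' assume *: "\<forall>x\<in>T. j \<le> pos x" and j': "j' \<in> {1..<j}"
  have "pos (of_nat j') = j'" using j' assms by (intro pos_of_nat) simp
  then show "of_nat j' \<notin> T" using * j' by force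
qed

lemma L_vector_in_S_set:
  assumes "j \<in> {1..9}" "card T = 3" "i \<in> T"
  shows "L_vector i T \<in> S_set j \<longleftrightarrow> pos i = j \<and> (\<forall>x\<in>T. j \<le> pos x)"
proof -
  have 1: "L_vector i T $ x = 0 \<longleftrightarrow> x \<notin> T" "L_vector i T $ x = -1 \<longleftrightarrow> x = i" for x using assms by (auto simp: L_vector_def)
  have "L_vector i T \<in> S_set j \<longleftrightarrow> (\<forall>j'\<in>{1..<j}. of_nat j' \<notin> T) \<and> of_nat j = i"
    unfolding S_set_def L162_eq using assms 1 by blast
  also have "of_nat j = i \<longleftrightarrow> pos i = j" using pos_of_nat[OF assms(1)] of_nat_pos by auto
  finally show ?thesis using avoid_iff[of j T] assms(1) by auto
qed

lemma L_vector_in_T_set: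
  assumes "s \<in> {1..9}" "card T = 3" "i \<in> T"
  shows "L_vector i T \<in> T_set s \<longleftrightarrow> pos i \<noteq> s \<and> (\<exists>y\<in>T. pos y = s) \<and> (\<forall>x\<in>T. s \<le> pos x)"
proof -
  have 1: "L_vector i T $ x = 0 \<longleftrightarrow> x \<notin> T" "L_vector i T $ x = 1 \<longleftrightarrow> x \<in> T \<and> x \<noteq> i" for x using assms by (auto simp: L_vector_def)
  have "L_vector i T \<in> T_set s \<longleftrightarrow> (\<forall>j'\<in>{1..<s}. of_nat j' \<notin> T) \<and> of_nat s \<in> T \<and> of_nat s \<noteq> i"
    unfolding T_set_def L162_eq using assms 1 by blast
  moreover have "of_nat s = i \<longleftrightarrow> pos i = s" using pos_of_nat[OF assms(1)] of_nat_pos by auto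
  moreover have "of_nat s \<in> T \<longleftrightarrow> (\<exists>y\<in>T. pos y = s)" using pos_of_nat[OF assms(1)] of_nat_pos by metis
  ultimately show ?thesis using avoid_iff[of s T] assms(1) by auto
qed

lemma image_Collect_2: "f ` {g x y | x y. P x y} = {f (g x y) | x y. P x y}"
  by blast

text \<open>This identifies the prescribed sets with the outcome of a ranking, namely that by the
  natural order of the coordinates.\<close>

lemma phi_image_ranked:
  assumes "s \<in> {1..9}" "c \<in> {1..9}"
  shows "phi ` (T_set s \<union> (\<Union>i\<in>{1..c}. S_set i)) = {point_iv i T | i T. card T = 3 \<and> i \<in> ranked s c pos T}"
proof -
  have 1: "L_vector i T \<in> T_set s \<union> (\<Union>i\<in>{1..c}. S_set i) \<longleftrightarrow> i \<in> ranked s c pos T"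
    if "card T = 3" "i \<in> T" for i T
  proof -
    have "L_vector i T \<in> (\<Union>i\<in>{1..c}. S_set i) \<longleftrightarrow> (\<exists>j\<in>{1..c}. pos i = j \<and> (\<forall>x\<in>T. j \<le> pos x))"
      using L_vector_in_S_set[OF _ that] assms(2) by auto
    also have "\<dots> \<longleftrightarrow> pos i \<le> c \<and> (\<forall>x\<in>T. pos i \<le> pos x)" using pos_range[of i] by auto
    finally show ?thesis using L_vector_in_T_set[OF assms(1) that] that by (auto simp: ranked_def)
  qed
  have sub: "T_set s \<union> (\<Union>i\<in>{1..c}. S_set i) \<subseteq> L162" by (auto simp: T_set_def S_set_def)
  have "T_set s \<union> (\<Union>i\<in>{1..c}. S_set i) = {L_vector i T | i T. card T = 3 \<and> i \<in> ranked s c pos T}" (is "?L = ?R")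
  proof (intro equalityI subsetI)
    fix x assume x: "x \<in> ?L"
    then have "x \<in> L162" using sub by (rule rev_subsetD)
    then obtain i T where iT: "x = L_vector i T" "card T = 3" "i \<in> T" unfolding L162_eq by auto
    then have "i \<in> ranked s c pos T" using x 1 by simp
    then show "x \<in> ?R" using iT by (intro CollectI exI conjI)
  next
    fix x assume "x \<in> ?R"
    then obtain i T where iT: "x = L_vector i T" "card T = 3" "i \<in> ranked s c pos T" by auto
    then have "i \<in> T" by (simp add: ranked_def)
    then show "x \<in> ?L" using iT 1 by simp
  qed
  moreover have "phi ` {L_vector i T | i T. card T = 3 \<and> i \<in> ranked s c pos T} =
    {phi (L_vector i T) | i T. card T = 3 \<and> i \<in> ranked s c pos T}" by (rule image_Collect_2)
  ultimately show ?thesis by (simp only: phi_L_vector)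
qed

subsection \<open>The extremal sets\<close>

lemma distance_sq_ne_10:
  assumes "distance_set 4 X" "J94 \<subseteq> X" "x \<in> X" "y \<in> X"
  shows "(dist x y)\<^sup>2 \<noteq> 10"
proof
  assume 10: "(dist x y)\<^sup>2 = 10"
  then have "x \<noteq> y" by auto
  then obtain k :: int where "k \<in> {1..4}" "(dist x y)\<^sup>2 = 2 * real_of_int k"
    using distances[OF assms(1,2,3,4)] by blast
  then show False using 10 by simp
qed

definition sources :: "(real^9) set \<Rightarrow> 9 set" where
  "sources X = {a. point_ii a \<in> X}"

definition centres :: "(real^9) set \<Rightarrow> 9 set \<Rightarrow> 9 set" where
  "centres X T = {i \<in> T. point_iv i T \<in> X}"

lemma centre_family_centres:
  assumes "distance_set 4 X" "J94 \<subseteq> X"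
  shows "centre_family (centres X)"
proof
  show "centres X T \<subseteq> T" for T by (auto simp: centres_def)
  fix i j k l
  assume *: "i \<in> centres X {i,j,k}" "j \<in> centres X {i,j,l}" "i \<noteq> j" "k \<notin> {i,j}" "l \<notin> {i,j}"
  then show "k = l"
    using dist_point_iv_point_iv[of i j k l] distance_sq_ne_10[OF assms, of "point_iv i {i,j,k}" "point_iv j {i,j,l}"]
    by (auto simp: centres_def)
qed

lemma sources_centres:
  assumes "distance_set 4 X" "J94 \<subseteq> X" "a \<in> sources X" "card T = 3" "a \<in> T"
  shows "centres X T \<subseteq> {a}"
proof
  fix i assume i: "i \<in> centres X T"
  show "i \<in> {a}"
  proof (rule ccontr)
    assume "i \<notin> {a}"
    then have ia: "i \<noteq> a" by simp
    have "i \<in> T" using i by (simp add: centres_def)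
    then obtain b where "T = {i,a,b}" "b \<noteq> i" "b \<noteq> a"
      using triple_pairE[OF assms(4) _ assms(5) ia] by blast
    then show False
      using dist_point_ii_point_iv[OF ia] distance_sq_ne_10[OF assms(1,2), of "point_ii a" "point_iv i T"] assms(3) i
      by (simp add: sources_def centres_def)
  qed
qed

definition points_iv :: "(9 set \<Rightarrow> 9 set) \<Rightarrow> (real^9) set" where
  "points_iv F = {point_iv i T | i T. card T = 3 \<and> i \<in> F T}"

lemma point_cover:
  assumes "X \<subseteq> {x. (\<Sum>i\<in>UNIV. x $ i) = 4}" "distance_set 4 X" "J94 \<subseteq> X"
  shows "X \<subseteq> J94 \<union> X_i \<union> X_iii \<union> point_ii ` sources X \<union> points_iv (centres X)"
proof
  fix x assume x: "x \<in> X"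
  show "x \<in> J94 \<union> X_i \<union> X_iii \<union> point_ii ` sources X \<union> points_iv (centres X)"
  proof (cases "x \<in> J94")
    case False
    have "\<exists>k\<in>{1..4::int}. 2 * (\<Sum>i\<in>S. x $ i) = (\<Sum>i\<in>UNIV. (x $ i)^2) + 4 - 2 * real_of_int k"
      if S: "card S = 4" for S
    proof -
      have "J_vector S \<in> J94" using S by (simp add: J94_eq)
      then have "J_vector S \<in> X" "x \<noteq> J_vector S" using assms(3) False by auto
      then obtain k :: int where k: "k \<in> {1..4}" "(dist x (J_vector S))\<^sup>2 = 2 * real_of_int k"
        using distances[OF assms(2,3) x] by blast
      then have "2 * (\<Sum>i\<in>S. x $ i) = (\<Sum>i\<in>UNIV. (x $ i)^2) + 4 - 2 * real_of_int k"
        using dist_J_vector[OF S, of x] by linarith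
      then show ?thesis using k(1) by (rule bexI)
    qed
    moreover have "(\<Sum>i\<in>UNIV. x $ i) = 4" using assms(1) x by auto
    ultimately have "(\<exists>a. x = point_iii a) \<or> (\<exists>a. x = point_ii a) \<or> (\<exists>E. card E = 2 \<and> x = point_i E) \<or>
      (\<exists>i T. i \<in> T \<and> card T = 3 \<and> x = point_iv i T)"
      by (intro point_classification)
    then show ?thesis
    proof (elim disjE exE conjE)
      fix a assume "x = point_iii a" then show ?thesis by (simp add: X_iii_eq)
    next
      fix a assume "x = point_ii a" then show ?thesis using x by (simp add: sources_def)
    next
      fix E :: "9 set" assume "card E = 2" "x = point_i E" then show ?thesis by (simp add: X_i_eq)
    next
      fix i T assume iT: "i \<in> T" "card T = 3" "x = point_iv i T"
      then have "i \<in> centres X T" using x by (simp add: centres_def)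
      then have "x \<in> points_iv (centres X)" unfolding points_iv_def using iT by blast
      then show ?thesis by simp
    qed
  qed simp
qed

text \<open>The constant is 171 = 126 + 36 + 9. An upper estimate suffices, so disjointness of the
  parts is not at issue.\<close>

lemma card_cover:
  shows "finite (J94 \<union> X_i \<union> X_iii \<union> point_ii ` A \<union> points_iv F)"
    and "card (J94 \<union> X_i \<union> X_iii \<union> point_ii ` A \<union> points_iv F) \<le> 171 + (card A + (\<Sum>T | card T = 3. card (F T)))"
proof -
  have P: "points_iv F = (\<lambda>(T,i). point_iv i T) ` (SIGMA T:{T. card T = 3}. F T)"
    by (force simp: points_iv_def)
  have fP: "finite (points_iv F)" unfolding P by simp
  have "card (points_iv F) \<le> card (SIGMA T:{T::9 set. card T = 3}. F T)" unfolding P by (rule card_image_le) simp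
  also have "\<dots> = (\<Sum>T | card T = 3. card (F T))" by simp
  finally have cP: "card (points_iv F) \<le> (\<Sum>T | card T = 3. card (F T))" .
  have "card J94 \<le> card {S :: 9 set. card S = 4}" unfolding J94_eq by (rule card_image_le) simp
  also have "\<dots> = 9 choose 4" using n_subsets[of "UNIV :: 9 set" 4] by simp
  finally have J: "card J94 \<le> 126" by (simp add: numeral_eq_Suc)
  have "card X_i \<le> card {S :: 9 set. card S = 2}" unfolding X_i_eq by (rule card_image_le) simp
  also have "\<dots> = 9 choose 2" using n_subsets[of "UNIV :: 9 set" 2] by simp
  finally have i: "card X_i \<le> 36" by (simp add: choose_two)
  have "card X_iii \<le> CARD(9)" unfolding X_iii_eq by (rule card_image_le) simp
  then have iii: "card X_iii \<le> 9" by simp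
  have A: "card (point_ii ` A) \<le> card A" by (rule card_image_le) simp
  show "finite (J94 \<union> X_i \<union> X_iii \<union> point_ii ` A \<union> points_iv F)"
    using fP by (simp add: J94_eq X_i_eq X_iii_eq)
  have "card (J94 \<union> X_i \<union> X_iii \<union> point_ii ` A \<union> points_iv F) \<le> card J94 + card X_i + card X_iii + card (point_ii ` A) + card (points_iv F)"
    by (meson add_le_mono card_Un_le le_refl order_trans)
  then show "card (J94 \<union> X_i \<union> X_iii \<union> point_ii ` A \<union> points_iv F) \<le> 171 + (card A + (\<Sum>T | card T = 3. card (F T)))"
    using cP J i iii A by linarith
qed

lemma permute_symmetric_parts:
  assumes p: "p permutes UNIV"
  shows "permute_coords p ` J94 = J94" "permute_coords p ` X_i = X_i" "permute_coords p ` X_iii = X_iii"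
proof -
  have "permute_coords p ` J94 = J_vector ` ((\<lambda>S. p -` S) ` {S. card S = 4})"
    unfolding J94_eq image_image permute_J_vector ..
  then show "permute_coords p ` J94 = J94" unfolding image_vimage_permutes[OF p] J94_eq .
  have "permute_coords p ` X_i = point_i ` ((\<lambda>S. p -` S) ` {S. card S = 2})"
    unfolding X_i_eq image_image permute_point_i ..
  then show "permute_coords p ` X_i = X_i" unfolding image_vimage_permutes[OF p] X_i_eq .
  have "permute_coords p ` X_iii = point_iii ` range (inv p)"
    unfolding X_iii_eq image_image permute_point_iii[OF p] ..
  also have "range (inv p) = UNIV" using permutes_inv[OF p] by (simp add: permutes_surj)
  finally show "permute_coords p ` X_iii = X_iii" unfolding X_iii_eq .
qed

text \<open>Permuting coordinates moves a distinguished index by \<open>inv p\<close>, so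
  \<open>p\<close> is the inverse of the map sending a vertex to the coordinate at its position; the
  ranking \<open>r\<close> is thereby carried to \<open>pos\<close>.\<close>

lemma permute_points_iv:
  assumes r: "bij_betw r UNIV {1..9::nat}" and p: "p = inv (\<lambda>i. of_nat (r i))"
  shows "p permutes (UNIV :: 9 set)"
    and "inv p i = of_nat (r i)"
    and "permute_coords p ` points_iv (ranked s c r) = points_iv (ranked s c pos)"
proof -
  let ?\<rho> = "\<lambda>i. of_nat (r i) :: 9"
  have "bij_betw of_nat {1..9::nat} (UNIV :: 9 set)" using of_nat_9 inj_of_nat_9 by (simp add: bij_betw_def)
  then have "bij_betw (of_nat \<circ> r) UNIV (UNIV :: 9 set)" using r by (rule bij_betw_trans[rotated])
  then have bij: "bij ?\<rho>" by (simp add: comp_def)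
  then show perm: "p permutes UNIV" unfolding p by (intro bij_imp_permutes bij_imp_bij_inv) simp_all
  have inv: "inv p = ?\<rho>" unfolding p using bij by (rule inv_inv_eq)
  then show "inv p i = of_nat (r i)" by simp
  have pos: "pos (?\<rho> i) = r i" for i
    using bij_betwE[OF r] by (intro pos_of_nat) auto
  have vim: "p -` T = ?\<rho> ` T" for T
    using bij_vimage_eq_inv_image[OF permutes_bij[OF perm], of T] inv by simp
  have rk: "i \<in> ranked s c r T \<longleftrightarrow> ?\<rho> i \<in> ranked s c pos (?\<rho> ` T)" for i T
  proof -
    have "?\<rho> i \<in> ?\<rho> ` T \<longleftrightarrow> i \<in> T" by (rule inj_image_mem_iff[OF bij_is_inj[OF bij]])
    then show ?thesis by (simp add: ranked_def pos)
  qed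
  have cd: "card (?\<rho> ` T) = card T" for T
    by (rule card_image[OF inj_on_subset[OF bij_is_inj[OF bij] subset_UNIV]])
  have "permute_coords p ` points_iv (ranked s c r) =
    {permute_coords p (point_iv i T) | i T. card T = 3 \<and> i \<in> ranked s c r T}"
    unfolding points_iv_def by (rule image_Collect_2)
  also have "\<dots> = {point_iv (?\<rho> i) (?\<rho> ` T) | i T. card (?\<rho> ` T) = 3 \<and> ?\<rho> i \<in> ranked s c pos (?\<rho> ` T)}"
    unfolding permute_point_iv[OF perm] inv vim cd rk ..
  also have "\<dots> = points_iv (ranked s c pos)"
  proof (intro equalityI subsetI)
    fix x assume "x \<in> points_iv (ranked s c pos)"
    then obtain i T where x: "x = point_iv i T" "card T = 3" "i \<in> ranked s c pos T" by (auto simp: points_iv_def)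
    obtain j where "i = ?\<rho> j" using bij by (metis bij_pointE)
    moreover have "T = ?\<rho> ` (?\<rho> -` T)" using bij by (simp add: bij_is_surj surj_image_vimage_eq)
    ultimately show "x \<in> {point_iv (?\<rho> i) (?\<rho> ` T) | i T. card (?\<rho> ` T) = 3 \<and> ?\<rho> i \<in> ranked s c pos (?\<rho> ` T)}"
      using x by (intro CollectI exI[of _ j] exI[of _ "?\<rho> -` T"]) simp
  qed (auto simp: points_iv_def)
  finally show "permute_coords p ` points_iv (ranked s c r) = points_iv (ranked s c pos)" .
qed

lemma X_iv_ranked:
  "X_iv' = points_iv (ranked 7 7 pos)" "X_iv'' = points_iv (ranked 6 5 pos)" "X_iv''' = points_iv (ranked 5 4 pos)"
  unfolding X_iv'_def X_iv''_def X_iv'''_def X6_def Y6_def Z6_def points_iv_def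
  by (rule phi_image_ranked; simp)+

lemma points_iv_cong: "(\<And>T. card T = 3 \<Longrightarrow> F T = G T) \<Longrightarrow> points_iv F = points_iv G"
  unfolding points_iv_def by metis

theorem theorem3p1:
  fixes X :: "(real ^ 9) set"
  assumes "X \<subseteq> {x. (\<Sum>i\<in>UNIV. x $ i) = 4}"
    and "distance_set 4 X"
    and "J94 \<subseteq> X"
  shows "card X \<le> 258 \<and>
    (card X = 258 \<longrightarrow>
      (\<exists>p. p permutes UNIV \<and>
        permute_coords p ` X \<in>
          {J94 \<union> X_i \<union> X_iii \<union> {vector (-4/3 # replicate 8 (2/3))} \<union> X_iv',
           J94 \<union> X_i \<union> X_iii \<union> {vector (-4/3 # replicate 8 (2/3))} \<union> X_iv'',
           J94 \<union> X_i \<union> X_iii \<union> {vector (-4/3 # replicate 8 (2/3))} \<union> X_iv'''}))"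
proof -
  let ?Y = "J94 \<union> X_i \<union> X_iii \<union> point_ii ` sources X \<union> points_iv (centres X)"
  let ?n = "card (sources X) + (\<Sum>T | card T = 3. card (centres X T))"
  interpret centre_family "centres X" by (rule centre_family_centres[OF assms(2,3)])
  have card9: "CARD(9) = 9" by simp
  have src: "centres X T \<subseteq> {a}" if "a \<in> sources X" "card T = 3" "a \<in> T" for a T
    by (rule sources_centres[OF assms(2,3) that])
  have bound: "?n \<le> 87" by (rule centres_and_sources(1)[OF card9]) (rule src)
  have sub: "X \<subseteq> ?Y" by (rule point_cover[OF assms])
  have XY: "card X \<le> card ?Y" by (rule card_mono[OF card_cover(1) sub])
  have Yn: "card ?Y \<le> 171 + ?n" by (rule card_cover(2))
  have "card X \<le> 258" using XY Yn bound by linarith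
  moreover have "\<exists>p. p permutes UNIV \<and>
        permute_coords p ` X \<in>
          {J94 \<union> X_i \<union> X_iii \<union> {vector (-4/3 # replicate 8 (2/3))} \<union> X_iv',
           J94 \<union> X_i \<union> X_iii \<union> {vector (-4/3 # replicate 8 (2/3))} \<union> X_iv'',
           J94 \<union> X_i \<union> X_iii \<union> {vector (-4/3 # replicate 8 (2/3))} \<union> X_iv'''}"
    if max: "card X = 258"
  proof -
    \<comment> \<open>With 258 = 171 + 87 all estimates are tight, and \<open>X\<close> fills its
      cover.\<close>
    have n: "?n = 87" and "card X = card ?Y" using max XY Yn bound by linarith+
    then have X: "X = ?Y" using card_subset_eq[OF card_cover(1) sub] by simp
    obtain r a s c where r: "bij_betw r UNIV {1..9}" and a: "sources X = {a}" "r a = 1"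
      and sc: "(s,c) \<in> {(7,7),(6,5),(5,4)}" and F: "\<And>T. card T = 3 \<Longrightarrow> centres X T = ranked s c r T"
    proof -
      have "\<exists>r a. bij_betw r UNIV {1..9} \<and> sources X = {a} \<and> r a = 1 \<and>
          (\<exists>(s,c)\<in>{(7,7),(6,5),(5,4)}. \<forall>T. card T = 3 \<longrightarrow> centres X T = ranked s c r T)"
        by (rule centres_and_sources(2)[OF card9 _ n]) (rule src)
      then show ?thesis using that by (auto simp del: insert_iff)
    qed
    define p where "p = inv (\<lambda>i. of_nat (r i) :: 9)"
    note perm = permute_points_iv[OF r p_def]
    have "points_iv (centres X) = points_iv (ranked s c r)" by (rule points_iv_cong[OF F])
    then have "X = J94 \<union> X_i \<union> X_iii \<union> {point_ii a} \<union> points_iv (ranked s c r)" using X a(1) by simp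
    \<comment> \<open>Since \<open>r a = 1\<close>, the exceptional coordinate of the point of the
      second type becomes the first one.\<close>
    then have "permute_coords p ` X = J94 \<union> X_i \<union> X_iii \<union> {point_ii 1} \<union> points_iv (ranked s c pos)"
      using permute_symmetric_parts[OF perm(1)] permute_point_ii[OF perm(1), of a] perm(2)[of a] perm(3)[of s c] a(2)
      by (simp add: image_Un)
    then have "permute_coords p ` X \<in>
          {J94 \<union> X_i \<union> X_iii \<union> {vector (-4/3 # replicate 8 (2/3))} \<union> X_iv',
           J94 \<union> X_i \<union> X_iii \<union> {vector (-4/3 # replicate 8 (2/3))} \<union> X_iv'',
           J94 \<union> X_i \<union> X_iii \<union> {vector (-4/3 # replicate 8 (2/3))} \<union> X_iv'''}"
      unfolding vector_point_ii X_iv_ranked using sc by (elim insertE emptyE) simp_all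
    then show ?thesis using perm(1) by blast
  qed
  ultimately show ?thesis by blast
qed

end
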